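(* Let $M_p$ be a weight sequence satisfying $(M.1)$, $(M.2)'$, $(QA)$ and $p!\subset M_p$. Let $\Omega\subseteq\mathbb{R}^d$ be open. A function $\varphi\in C^\infty(\Omega)$ belongs to $\mathcal{E}^{\{M_p\}}(\Omega)$ if and only if $$\|\varphi\|_{K,r_j}:=\sup_{\alpha\in\mathbb{N}^d}\sup_{x\in K}\frac{|\varphi^{(\alpha)}(x)|}{M_\alpha\prod_{j=0}^{|\alpha|}r_j}<\infty$$ for all compact $K\subset\Omega$ and all $(r_j)\in\mathcal{R}$. Moreover, the topology of $\mathcal{E}^{\{M_p\}}(\Omega)$ is generated by the system of seminorms $\|\cdot\|_{K,r_j}$ ($K\subset\Omega$ compact, $(r_j)\in\mathcal{R}$).
   Context: $\mathbb{N}=\{0,1,2,\dots\}$. A weight sequence is a sequence $(M_p)_{p\in\mathbb{N}}$ of positive reals with $M_0=1$ and $m_p:=M_p/M_{p-1}\to\infty$. Conditions: $(M.1)$ $M_p^2\le M_{p-1}M_{p+1}$ for $p\ge1$; $(M.2)'$ there are $A,H\ge1$ with $M_{p+1}\le AH^{p+1}M_p$ for all $p\in\mathbb{N}$; $(QA)$ $\sum_{p\ge1}1/m_p=\infty$. $p!\subset M_p$ means that there are $C,h>0$ with $p!\le Ch^pM_p$ for all $p$. Put $M_\alpha=M_{|\alpha|}$ for $\alpha\in\mathbb{N}^d$. For a regular compact set $K\subset\mathbb{R}^d$ (i.e. $\overline{\operatorname{int}K}=K$) and $h>0$, $\mathcal{E}^{M_p,h}(K)$ is the Banach space of all $\varphi\in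 C^\infty(K)$ (smooth on $\operatorname{int}K$, all derivatives extending continuously to $K$) with $\|\varphi\|_{K,h}:=\sup_{\alpha}\sup_{x\in K}|\varphi^{(\alpha)}(x)|/(h^{|\alpha|}M_\alpha)<\infty$. For $\Omega\subseteq\mathbb{R}^d$ open, $\mathcal{E}^{\{M_p\}}(\Omega)=\varprojlim_{K\Subset\Omega}\varinjlim_{h\to\infty}\mathcal{E}^{M_p,h}(K)$ as a locally convex space. $\mathcal{R}$ is the family of positive real sequences $(r_j)_{j\in\mathbb{N}}$ with $r_0=1$ which increase (not necessarily strictly) to infinity. *)

theory Defs
  imports "HOL-Analysis.Analysis"
begin

section \<open>Weight sequences\<close>

definition weight_quot :: "(nat \<Rightarrow> real) \<Rightarrow> nat \<Rightarrow> real" where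
  "weight_quot M p = M p / M (p - 1)"

definition weight_sequence :: "(nat \<Rightarrow> real) \<Rightarrow> bool" where
  "weight_sequence M \<longleftrightarrow>
     (\<forall>p. M p > 0) \<and> M 0 = 1 \<and> filterlim (weight_quot M) at_top sequentially"

definition cond_M1 :: "(nat \<Rightarrow> real) \<Rightarrow> bool" where
  "cond_M1 M \<longleftrightarrow> (\<forall>p\<ge>1. (M p)\<^sup>2 \<le> M (p - 1) * M (p + 1))"

definition cond_M2' :: "(nat \<Rightarrow> real) \<Rightarrow> bool" where
  "cond_M2' M \<longleftrightarrow> (\<exists>A\<ge>1. \<exists>H\<ge>1. \<forall>p. M (p + 1) \<le> A * H ^ (p + 1) * M p)"

definition cond_QA :: "(nat \<Rightarrow> real) \<Rightarrow> bool" where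
  "cond_QA M \<longleftrightarrow> filterlim (\<lambda>n. \<Sum>p=1..n. 1 / weight_quot M p) at_top sequentially"

definition fact_subset :: "(nat \<Rightarrow> real) \<Rightarrow> bool" where
  "fact_subset M \<longleftrightarrow> (\<exists>C>0. \<exists>h>0. \<forall>p. fact p \<le> C * h ^ p * M p)"

definition seqs_R :: "(nat \<Rightarrow> real) set" where
  "seqs_R = {r. (\<forall>j. r j > 0) \<and> r 0 = 1 \<and> incseq r \<and> filterlim r at_top sequentially}"


section \<open>Partial derivatives and smooth functions\<close>

text \<open>A complex-valued function on a set \<open>S\<close> is encoded as a total function that vanishes
  off \<open>S\<close>, so that the vector space operations are the pointwise ones.\<close>

definition supp_in :: "'a set \<Rightarrow> ('a \<Rightarrow> complex) set" where
  "supp_in S = {f. \<forall>x. x \<notin> S \<longrightarrow> f x = 0}"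

definition restr :: "'a set \<Rightarrow> ('a \<Rightarrow> complex) \<Rightarrow> 'a \<Rightarrow> complex" where
  "restr S f = (\<lambda>x. if x \<in> S then f x else 0)"

definition pd :: "'n::finite \<Rightarrow> (real^'n \<Rightarrow> complex) \<Rightarrow> real^'n \<Rightarrow> complex" where
  "pd i f x = frechet_derivative f (at x) (axis i 1)"

fun iter_pd :: "'n::finite list \<Rightarrow> (real^'n \<Rightarrow> complex) \<Rightarrow> real^'n \<Rightarrow> complex" where
  "iter_pd [] f = f"
| "iter_pd (i # is) f = pd i (iter_pd is f)"

definition smooth_on :: "(real^'n::finite) set \<Rightarrow> (real^'n \<Rightarrow> complex) \<Rightarrow> bool" where
  "smooth_on U f \<longleftrightarrow> (\<forall>is. iter_pd is f differentiable_on U)"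

text \<open>The derivative \<open>f\<^sup>(\<^sup>\<alpha>\<^sup>)\<close>. The choice of the order of differentiation is immaterial for
  smooth functions.\<close>

definition mpd :: "('n::finite \<Rightarrow> nat) \<Rightarrow> (real^'n \<Rightarrow> complex) \<Rightarrow> real^'n \<Rightarrow> complex" where
  "mpd \<alpha> f = iter_pd (SOME is. \<forall>i. count_list is i = \<alpha> i) f"

definition mi_abs :: "('n::finite \<Rightarrow> nat) \<Rightarrow> nat" where
  "mi_abs \<alpha> = (\<Sum>i\<in>UNIV. \<alpha> i)"

definition C_inf :: "(real^'n::finite) set \<Rightarrow> (real^'n \<Rightarrow> complex) set" where
  "C_inf \<Omega> = {f \<in> supp_in \<Omega>. smooth_on \<Omega> f}"

definition is_ext_pd ::
  "(real^'n::finite) set \<Rightarrow> ('n \<Rightarrow> nat) \<Rightarrow> (real^'n \<Rightarrow> complex) \<Rightarrow> (real^'n \<Rightarrow> complex) \<Rightarrow> bool" where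
  "is_ext_pd K \<alpha> f g \<longleftrightarrow> continuous_on K g \<and> (\<forall>x\<in>interior K. g x = mpd \<alpha> f x)"

text \<open>The continuous extension of \<open>f\<^sup>(\<^sup>\<alpha>\<^sup>)\<close> from \<open>interior K\<close> to \<open>K\<close>; its values on \<open>K\<close> are unique
  when \<open>K\<close> is regular.\<close>

definition ext_pd ::
  "(real^'n::finite) set \<Rightarrow> ('n \<Rightarrow> nat) \<Rightarrow> (real^'n \<Rightarrow> complex) \<Rightarrow> real^'n \<Rightarrow> complex" where
  "ext_pd K \<alpha> f = (SOME g. is_ext_pd K \<alpha> f g)"

definition C_inf_compact :: "(real^'n::finite) set \<Rightarrow> (real^'n \<Rightarrow> complex) set" where
  "C_inf_compact K =
     {f \<in> supp_in K. continuous_on K f \<and> smooth_on (interior K) f \<and> (\<forall>\<alpha>. \<exists>g. is_ext_pd K \<alpha> f g)}"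


section \<open>Locally convex topologies\<close>

definition seminorm_on :: "('a \<Rightarrow> complex) set \<Rightarrow> (('a \<Rightarrow> complex) \<Rightarrow> real) \<Rightarrow> bool" where
  "seminorm_on V p \<longleftrightarrow>
     (\<forall>f\<in>V. p f \<ge> 0) \<and>
     (\<forall>f\<in>V. \<forall>g\<in>V. p (\<lambda>x. f x + g x) \<le> p f + p g) \<and>
     (\<forall>c. \<forall>f\<in>V. p (\<lambda>x. c * f x) = cmod c * p f)"

definition sball ::
  "('a \<Rightarrow> complex) set \<Rightarrow> (('a \<Rightarrow> complex) \<Rightarrow> real) \<Rightarrow> ('a \<Rightarrow> complex) \<Rightarrow> real \<Rightarrow> ('a \<Rightarrow> complex) set" where
  "sball V p f e = {g \<in> V. p (\<lambda>x. g x - f x) < e}"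

definition seminorm_topology ::
  "('a \<Rightarrow> complex) set \<Rightarrow> (('a \<Rightarrow> complex) \<Rightarrow> real) set \<Rightarrow> ('a \<Rightarrow> complex) topology" where
  "seminorm_topology V P = topology_generated_by
     (insert V {sball V p f e | p f e. p \<in> P \<and> f \<in> V \<and> e > 0})"

definition lc_topology :: "('a \<Rightarrow> complex) set \<Rightarrow> ('a \<Rightarrow> complex) topology \<Rightarrow> bool" where
  "lc_topology V T \<longleftrightarrow> (\<exists>P. (\<forall>p\<in>P. seminorm_on V p) \<and> T = seminorm_topology V P)"

text \<open>The locally convex inductive limit of spaces \<open>X i\<close> included in \<open>V\<close>: the supremum of all
  locally convex topologies on \<open>V\<close> making every inclusion continuous. It is again such a
  topology, hence the finest one.\<close>

definition lc_inductive_topology ::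
  "('a \<Rightarrow> complex) set \<Rightarrow> 'i set \<Rightarrow> ('i \<Rightarrow> ('a \<Rightarrow> complex) topology) \<Rightarrow> ('a \<Rightarrow> complex) topology" where
  "lc_inductive_topology V I X = topology_generated_by
     {U. \<exists>T. lc_topology V T \<and> (\<forall>i\<in>I. continuous_map (X i) T (\<lambda>f. f)) \<and> openin T U}"


section \<open>Ultradifferentiable functions of Roumieu type\<close>

definition wsup ::
  "(real^'n::finite) set \<Rightarrow> (nat \<Rightarrow> real) \<Rightarrow> (('n \<Rightarrow> nat) \<Rightarrow> real^'n \<Rightarrow> complex) \<Rightarrow> ennreal" where
  "wsup K w D = (SUP \<alpha>. SUP x\<in>K. ennreal (cmod (D \<alpha> x) / w (mi_abs \<alpha>)))"

definition norm_h ::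
  "(nat \<Rightarrow> real) \<Rightarrow> real \<Rightarrow> (real^'n::finite) set \<Rightarrow> (real^'n \<Rightarrow> complex) \<Rightarrow> ennreal" where
  "norm_h M h K f = wsup K (\<lambda>p. h ^ p * M p) (\<lambda>\<alpha>. ext_pd K \<alpha> f)"

definition norm_r ::
  "(nat \<Rightarrow> real) \<Rightarrow> (nat \<Rightarrow> real) \<Rightarrow> (real^'n::finite) set \<Rightarrow> (real^'n \<Rightarrow> complex) \<Rightarrow> ennreal" where
  "norm_r M r K f = wsup K (\<lambda>p. M p * (\<Prod>j=0..p. r j)) (\<lambda>\<alpha>. mpd \<alpha> f)"

definition E_h ::
  "(nat \<Rightarrow> real) \<Rightarrow> real \<Rightarrow> (real^'n::finite) set \<Rightarrow> (real^'n \<Rightarrow> complex) set" where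
  "E_h M h K = {f \<in> C_inf_compact K. norm_h M h K f < \<infinity>}"

definition E_h_topology ::
  "(nat \<Rightarrow> real) \<Rightarrow> real \<Rightarrow> (real^'n::finite) set \<Rightarrow> (real^'n \<Rightarrow> complex) topology" where
  "E_h_topology M h K = seminorm_topology (E_h M h K) {\<lambda>f. enn2real (norm_h M h K f)}"

definition E_compact ::
  "(nat \<Rightarrow> real) \<Rightarrow> (real^'n::finite) set \<Rightarrow> (real^'n \<Rightarrow> complex) set" where
  "E_compact M K = (\<Union>h\<in>{0<..}. E_h M h K)"

definition E_compact_topology ::
  "(nat \<Rightarrow> real) \<Rightarrow> (real^'n::finite) set \<Rightarrow> (real^'n \<Rightarrow> complex) topology" where
  "E_compact_topology M K =
     lc_inductive_topology (E_compact M K) {0<..} (\<lambda>h. E_h_topology M h K)"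

definition regular_compacts :: "(real^'n::finite) set \<Rightarrow> (real^'n) set set" where
  "regular_compacts \<Omega> = {K. compact K \<and> closure (interior K) = K \<and> K \<subseteq> \<Omega>}"

text \<open>The projective limit over the regular compact subsets of \<open>\<Omega>\<close>. As the interiors of these
  sets cover \<open>\<Omega>\<close>, the compatible families \<open>(\<phi>\<^sub>K)\<close> are exactly the families of restrictions of
  functions \<open>\<phi>\<close> on \<open>\<Omega>\<close>; the topology is the one induced by the product topology.\<close>

definition E_open ::
  "(nat \<Rightarrow> real) \<Rightarrow> (real^'n::finite) set \<Rightarrow> (real^'n \<Rightarrow> complex) set" where
  "E_open M \<Omega> = {\<phi> \<in> supp_in \<Omega>. \<forall>K\<in>regular_compacts \<Omega>. restr K \<phi> \<in> E_compact M K}"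

definition E_open_topology ::
  "(nat \<Rightarrow> real) \<Rightarrow> (real^'n::finite) set \<Rightarrow> (real^'n \<Rightarrow> complex) topology" where
  "E_open_topology M \<Omega> =
     pullback_topology (supp_in \<Omega>) (\<lambda>\<phi>. \<lambda>K\<in>regular_compacts \<Omega>. restr K \<phi>)
       (product_topology (E_compact_topology M) (regular_compacts \<Omega>))"

lemma sball_subset: "sball V p f e \<subseteq> V"
  by (auto simp: sball_def)

lemma topspace_seminorm_topology [simp]: "topspace (seminorm_topology V P) = V"
  unfolding seminorm_topology_def topology_generated_by_topspace
  using sball_subset by fast

lemma continuous_map_generated_insert:
  assumes "\<Union>S \<subseteq> V"
  shows "continuous_map X (topology_generated_by (insert V S)) F \<longleftrightarrow>
    F ` topspace X \<subseteq> V \<and> (\<forall>U\<in>S. openin X (F -` U \<inter> topspace X))"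
proof -
  have un: "\<Union>(insert V S) = V" using assms by auto
  have "F -` V \<inter> topspace X = topspace X" if "F ` topspace X \<subseteq> V" using that by auto
  then show ?thesis
    unfolding continuous_on_generated_topo_iff un by auto
qed

lemma continuous_map_seminorm_topology_iff:
  "continuous_map X (seminorm_topology V P) F \<longleftrightarrow>
     F ` topspace X \<subseteq> V \<and>
     (\<forall>p\<in>P. \<forall>f\<in>V. \<forall>e>0. openin X (F -` sball V p f e \<inter> topspace X))"
proof -
  have "\<Union>{sball V p f e | p f e. p \<in> P \<and> f \<in> V \<and> e > 0} \<subseteq> V"
    using sball_subset by fast
  then show ?thesis
    unfolding seminorm_topology_def by (simp only: continuous_map_generated_insert) blast
qed

text \<open>The inductive limit topology is the one given by all seminorms that are continuous on
  each step.\<close>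

lemma lc_inductive_topology_eq:
  assumes X: "\<And>i. i \<in> I \<Longrightarrow> topspace (X i) \<subseteq> V"
  shows "lc_inductive_topology V I X = seminorm_topology V
    {p. seminorm_on V p \<and> (\<forall>i\<in>I. continuous_map (X i) (seminorm_topology V {p}) (\<lambda>f. f))}"
    (is "_ = seminorm_topology V ?P")
proof -
  let ?G = "{U. \<exists>T. lc_topology V T \<and> (\<forall>i\<in>I. continuous_map (X i) T (\<lambda>f. f)) \<and> openin T U}"
  have cont: "continuous_map (X i) (seminorm_topology V ?P) (\<lambda>f. f)" if "i \<in> I" for i
    proof -
    have "openin (X i) ((\<lambda>f. f) -` sball V p f e \<inter> topspace (X i))"
      if "p \<in> ?P" "f \<in> V" "e > 0" for p f e
      using that \<open>i \<in> I\<close> by (simp add: continuous_map_seminorm_topology_iff)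
    then show ?thesis
      using X[OF that] unfolding continuous_map_seminorm_topology_iff by (simp only: image_ident) blast
  qed
  have lc: "lc_topology V (seminorm_topology V ?P)"
    unfolding lc_topology_def by (intro exI[of _ ?P]) simp
  have 1: "openin (seminorm_topology V ?P) U" if "U \<in> ?G" for U
  proof -
    from that obtain T where "lc_topology V T"
      and cT: "\<forall>i\<in>I. continuous_map (X i) T (\<lambda>f. f)" and UT: "openin T U"
      unfolding mem_Collect_eq by (elim exE conjE) rule
    then obtain P where P: "\<forall>p\<in>P. seminorm_on V p" and T: "T = seminorm_topology V P"
      unfolding lc_topology_def by (elim exE conjE) rule
    have c: "\<forall>i\<in>I. continuous_map (X i) (seminorm_topology V P) (\<lambda>f. f)"
      and U: "openin (seminorm_topology V P) U"
      using cT UT unfolding T .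
    have "P \<subseteq> ?P"
    proof (intro subsetI CollectI conjI ballI)
      fix p i
      assume p: "p \<in> P" and i: "i \<in> I"
      show "continuous_map (X i) (seminorm_topology V {p}) (\<lambda>f. f)"
        using c[rule_format, OF i] p by (simp add: continuous_map_seminorm_topology_iff)
    qed (use P in blast)
    then have sub: "insert V {sball V p f e | p f e. p \<in> P \<and> f \<in> V \<and> e > 0}
      \<subseteq> insert V {sball V p f e | p f e. p \<in> ?P \<and> f \<in> V \<and> e > 0}"
      (is "?A \<subseteq> ?B")
      by (intro insert_mono) blast
    from U have "generate_topology_on ?A U"
      unfolding seminorm_topology_def by (rule openin_topology_generated_by)
    then have "openin (topology_generated_by ?B) U"
    proof induction
      case (Basis s)
      then show ?case using sub by (intro topology_generated_by_Basis) (rule subsetD)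
    qed (auto intro: openin_Union)
    then show ?thesis unfolding seminorm_topology_def .
  qed
  show ?thesis
  proof (rule topology_eq[THEN iffD2], intro allI iffI)
    fix U
    assume "openin (lc_inductive_topology V I X) U"
    then have "generate_topology_on ?G U"
      unfolding lc_inductive_topology_def by (rule openin_topology_generated_by)
    then show "openin (seminorm_topology V ?P) U"
      by induction (auto intro: 1)
  next
    fix U
    assume "openin (seminorm_topology V ?P) U"
    then have "U \<in> ?G"
      using lc cont by (intro CollectI exI[of _ "seminorm_topology V ?P"] conjI ballI) assumption+
    then show "openin (lc_inductive_topology V I X) U"
      unfolding lc_inductive_topology_def by (rule topology_generated_by_Basis)
  qed
qed

lemma topspace_E_compact_topology [simp]: "topspace (E_compact_topology M K) = E_compact M K"
proof -
  have "\<And>h. h \<in> {0<..} \<Longrightarrow> topspace (E_h_topology M h K) \<subseteq> E_compact M K"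
    by (auto simp: E_h_topology_def E_compact_def)
  then show ?thesis
    unfolding E_compact_topology_def by (subst lc_inductive_topology_eq) simp_all
qed

lemma topspace_E_open_topology [simp]: "topspace (E_open_topology M \<Omega>) = E_open M \<Omega>"
  unfolding E_open_topology_def E_open_def topspace_pullback_topology topspace_product_topology
  by (auto simp: PiE_iff)

end

theory Submission
  imports Defs "HOL-Complex_Analysis.Great_Picard"
begin

text \<open>A sequence that is dominated by \<open>\<Prod>j\<le>p. r j\<close> for every \<open>r\<close> in \<open>seqs_R\<close> is dominated by a
  power \<open>h ^ p\<close>: otherwise a slowly growing step sequence \<open>r\<close> violates the domination at its jumps.
  This gives the description of the space.

  For the topology, let \<open>q\<close> be a seminorm that is continuous on every step over \<open>K\<close>, and let \<open>U\<close> be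
  a neighbourhood of \<open>K\<close>. By the Arzela-Ascoli theorem a class of functions on \<open>U\<close> with bounds
  \<open>C * h ^ p * M p\<close> on the derivatives is relatively compact in the step \<open>2 * h\<close> over \<open>K\<close>. Hence, if
  \<open>q < c\<close> on a class with bounds \<open>b p * M p\<close>, then this persists when \<open>b p\<close> is enlarged for all
  sufficiently large \<open>p\<close>. Enlarging successively from \<open>k ^ p\<close> to \<open>(k + 1) ^ p\<close> beyond thresholds
  \<open>P k\<close> yields \<open>q < c\<close> on the unit ball of a seminorm \<open>norm_r M r\<close>, where \<open>r\<close> jumps at the
  thresholds.\<close>

section \<open>Iterated partial derivatives\<close>

text \<open>The class with bounds \<Prod>j\<le>p. r j need not lie in any single stage of the
  enlargement: the bounds of stage \<open>k\<close> never exceed \<open>(k + 1) ^ p\<close>, while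
  \<open>r\<close> is unbounded. What rescues the limit is that a function in
  \<open>E_open M \<Omega>\<close> also obeys some geometric bound on the compact neighbourhood, so
  each function, taken alone, falls into some stage, and \<open>q < c\<close> holds there. Hence the
  second membership in \<open>ex_seqs_R_ball\<close>.

  The inductive limit enters only through \<open>lc_inductive_topology_eq\<close>: its topology
  comes from the seminorms continuous on every step, so it is enough to dominate each such
  \<open>q\<close> by one \<open>norm_r\<close>. Conversely, \<open>norm_r\<close> is continuous
  because \<open>h ^ p\<close> is at most a constant times \<Prod>j\<le>p. r j, as \<open>r\<close>
  eventually exceeds \<open>h\<close>.

  Seminorms over an arbitrary compact \<open>K\<close> are read on a regular compact neighbourhood:
  \<open>K\<close> may have empty interior, and then \<open>restr K\<close> forgets the derivatives
  on \<open>K\<close>.\<close>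

lemma pd_cong:
  assumes "open U" "x \<in> U" "\<And>y. y \<in> U \<Longrightarrow> f y = g y"
  shows "pd i f x = pd i g x"
proof -
  have "(f has_derivative D) (at x) \<longleftrightarrow> (g has_derivative D) (at x)" for D
    using assms by (metis has_derivative_transform_within_open)
  \<comment> \<open>Differentiability is not assumed: the choice in
    \<open>frechet_derivative\<close> is made among the same candidates for \<open>f\<close> and
    \<open>g\<close>, so the values agree even if there are none.\<close>
  then show ?thesis unfolding pd_def frechet_derivative_def by simp
qed

lemma iter_pd_cong:
  assumes "open U" "x \<in> U" "\<And>y. y \<in> U \<Longrightarrow> f y = g y"
  shows "iter_pd is f x = iter_pd is g x"
  using assms(2)
proof (induction "is" arbitrary: x)
  case (Cons i "is")
  then show ?case unfolding iter_pd.simps by (intro pd_cong[OF assms(1)])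
qed (use assms(3) in simp)

lemma iter_pd_append: "iter_pd (is @ js) f = iter_pd is (iter_pd js f)"
  by (induction "is") auto

lemma smooth_on_iff_differentiable_at:
  assumes "open U"
  shows "smooth_on U f \<longleftrightarrow> (\<forall>is. \<forall>x\<in>U. iter_pd is f differentiable (at x))"
  unfolding smooth_on_def differentiable_on_def
  by (simp only: at_within_open[OF _ assms] cong: ball_cong)

lemma smooth_on_subset:
  assumes "smooth_on U f" "V \<subseteq> U"
  shows "smooth_on V f"
  using assms differentiable_on_subset unfolding smooth_on_def by blast

lemma smooth_on_cong:
  assumes "open U" "smooth_on U f" "\<And>y. y \<in> U \<Longrightarrow> f y = g y"
  shows "smooth_on U g"
proof -
  have "iter_pd is g differentiable (at x)" if "x \<in> U" for "is" x
  proof -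
    have "iter_pd is f differentiable (at x)"
      using assms(1,2) that by (simp add: smooth_on_iff_differentiable_at)
    moreover have "iter_pd is f y = iter_pd is g y" if "y \<in> U" for y
      using iter_pd_cong[OF assms(1) that assms(3)] .
    ultimately show ?thesis
      unfolding differentiable_def using has_derivative_transform_within_open[OF _ assms(1) that]
      by blast
  qed
  then show ?thesis using assms(1) by (simp add: smooth_on_iff_differentiable_at)
qed

lemma smooth_on_iter_pd:
  assumes "smooth_on U f"
  shows "smooth_on U (iter_pd is f)"
  using assms unfolding smooth_on_def iter_pd_append[symmetric] by blast

lemma smooth_on_imp_continuous_on:
  "smooth_on U f \<Longrightarrow> continuous_on U (iter_pd is f)"
  unfolding smooth_on_def by (rule differentiable_imp_continuous_on) (erule spec)

lemma has_derivative_pd: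
  assumes "f differentiable (at x)"
  shows "(f has_derivative (\<lambda>v. \<Sum>i\<in>UNIV. (v $ i) *\<^sub>R pd i f x)) (at x)"
proof -
  let ?D = "frechet_derivative f (at x)"
  have D: "(f has_derivative ?D) (at x)" using assms frechet_derivative_works by blast
  have lin: "linear ?D" using assms by (rule linear_frechet_derivative)
  have "?D v = (\<Sum>i\<in>UNIV. (v $ i) *\<^sub>R pd i f x)" for v
  proof -
    have "?D v = ?D (\<Sum>i\<in>UNIV. (v $ i) *\<^sub>R axis i 1)"
      using basis_expansion[of v] by (simp add: scalar_mult_eq_scaleR)
    also have "\<dots> = (\<Sum>i\<in>UNIV. ?D ((v $ i) *\<^sub>R axis i 1))"
      by (rule linear_sum[OF lin])
    finally show ?thesis by (simp add: pd_def linear_cmul[OF lin])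
  qed
  then have "?D = (\<lambda>v. \<Sum>i\<in>UNIV. (v $ i) *\<^sub>R pd i f x)" by blast
  with D show ?thesis by simp
qed

lemma pd_eqI:
  assumes "(f has_derivative D) (at x)"
  shows "pd i f x = D (axis i 1)"
  using frechet_derivative_at[OF assms] by (simp add: pd_def)

lemma pd_linear_combination:
  assumes "f differentiable (at x)" "g differentiable (at x)"
  shows "pd i (\<lambda>x. c * f x + d * g x) x = c * pd i f x + d * pd i g x"
proof -
  have "((\<lambda>x. c * f x + d * g x) has_derivative
      (\<lambda>v. c * frechet_derivative f (at x) v + d * frechet_derivative g (at x) v)) (at x)"
    using assms unfolding frechet_derivative_works by (intro derivative_intros)
  from pd_eqI[OF this] show ?thesis by (simp add: pd_def)
qed

lemma iter_pd_linear_combination: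
  assumes "open U" "smooth_on U f" "smooth_on U g" "x \<in> U"
  shows "iter_pd is (\<lambda>x. c * f x + d * g x) x = c * iter_pd is f x + d * iter_pd is g x"
  using assms(4)
proof (induction "is" arbitrary: x)
  case (Cons i "is")
  have "pd i (iter_pd is (\<lambda>x. c * f x + d * g x)) x
      = pd i (\<lambda>x. c * iter_pd is f x + d * iter_pd is g x) x"
    using Cons by (intro pd_cong[OF assms(1)])
  also have "\<dots> = c * pd i (iter_pd is f) x + d * pd i (iter_pd is g) x"
    using assms Cons.prems by (intro pd_linear_combination) (simp_all add: smooth_on_iff_differentiable_at)
  finally show ?case by simp
qed simp

lemma smooth_on_linear_combination:
  assumes "open U" "smooth_on U f" "smooth_on U g"
  shows "smooth_on U (\<lambda>x. c * f x + d * g x)"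
proof -
  have "iter_pd is (\<lambda>x. c * f x + d * g x) differentiable (at x)" if "x \<in> U" for "is" x
  proof -
    have "(\<lambda>x. c * iter_pd is f x + d * iter_pd is g x) differentiable (at x)"
      using assms that by (intro derivative_intros) (simp_all add: smooth_on_iff_differentiable_at)
    then obtain D where "((\<lambda>x. c * iter_pd is f x + d * iter_pd is g x) has_derivative D) (at x)"
      unfolding differentiable_def by blast
    then have "(iter_pd is (\<lambda>x. c * f x + d * g x) has_derivative D) (at x)"
      by (rule has_derivative_transform_within_open[OF _ assms(1) that])
        (simp add: iter_pd_linear_combination[OF assms])
    then show ?thesis unfolding differentiable_def by blast
  qed
  then show ?thesis using assms(1) by (simp add: smooth_on_iff_differentiable_at)
qed

section \<open>Symmetry of mixed partial derivatives\<close>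

lemma has_vector_derivative_pd_line:
  assumes "f differentiable (at (x + s *\<^sub>R axis i 1))"
  shows "((\<lambda>s. f (x + s *\<^sub>R axis i 1)) has_vector_derivative pd i f (x + s *\<^sub>R axis i 1)) (at s)"
proof -
  let ?y = "x + s *\<^sub>R axis i 1"
  let ?D = "frechet_derivative f (at ?y)"
  have D: "(f has_derivative ?D) (at ?y)" using assms frechet_derivative_works by blast
  have "((\<lambda>s. x + s *\<^sub>R axis i 1) has_derivative (\<lambda>t. t *\<^sub>R axis i 1)) (at s)"
    by (auto intro!: derivative_eq_intros)
  from has_derivative_compose[OF this D]
  have "((\<lambda>s. f (x + s *\<^sub>R axis i 1)) has_derivative (\<lambda>t. ?D (t *\<^sub>R axis i 1))) (at s)" .
  then show ?thesis
    by (simp add: has_vector_derivative_def pd_def linear_cmul[OF linear_frechet_derivative[OF assms]])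
qed

lemma onorm_scaleR_right_le:
  assumes "norm w \<le> e"
  shows "onorm (\<lambda>h::real. h *\<^sub>R w) \<le> e"
proof (rule onorm_le)
  show "norm (h *\<^sub>R w) \<le> e * norm h" for h
    using mult_right_mono[OF assms, of "norm h"] by (simp add: mult.commute)
qed

text \<open>The second difference quotient is compared with the mixed derivative. It is symmetric in
  \<open>i\<close> and \<open>j\<close>, whence Schwarz's theorem.\<close>

lemma second_difference_bound:
  fixes f :: "real^'n::finite \<Rightarrow> complex"
  assumes smooth: "\<And>y. y \<in> ball x (2 * d) \<Longrightarrow> f differentiable (at y) \<and> pd i f differentiable (at y)"
    and bound: "\<And>y. y \<in> ball x (2 * d) \<Longrightarrow> cmod (pd j (pd i f) y - D) \<le> e"
    and d: "0 < d" "0 \<le> s" "s < d" "0 \<le> t" "t < d"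
  shows "cmod (f (x + s *\<^sub>R axis i 1 + t *\<^sub>R axis j 1) - f (x + s *\<^sub>R axis i 1)
    - f (x + t *\<^sub>R axis j 1) + f x - (s * t) *\<^sub>R D) \<le> e * s * t"
proof -
  \<comment> \<open>Two displacements shorter than \<open>d\<close> add up to less than
    \<open>2 * d\<close>, hence the radius in the hypotheses.\<close>
  have in_ball: "x + a *\<^sub>R axis i 1 + b *\<^sub>R axis j 1 \<in> ball x (2 * d)"
    if "0 \<le> a" "a < d" "0 \<le> b" "b < d" for a b
  proof -
    have "norm (a *\<^sub>R axis i (1::real) + b *\<^sub>R axis j 1) \<le> a + b"
      using that by (intro norm_triangle_le) simp
    moreover have "dist (x + (a *\<^sub>R axis i 1 + b *\<^sub>R axis j 1)) x
        = norm (a *\<^sub>R axis i (1::real) + b *\<^sub>R axis j 1)"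
      unfolding dist_norm add_diff_cancel_left' ..
    ultimately show ?thesis using that by (simp add: add.assoc dist_commute)
  qed
  \<comment> \<open>The mean value inequality is used twice. Here it acts in direction
    \<open>j\<close> on \<open>pd i f\<close> minus a linear term; the resulting
    \<open>e * t\<close> is then the derivative bound for the same inequality in direction
    \<open>i\<close>.\<close>
  have inner: "cmod (pd i f (x + a *\<^sub>R axis i 1 + t *\<^sub>R axis j 1) - pd i f (x + a *\<^sub>R axis i 1) - t *\<^sub>R D)
      \<le> e * t" if a: "0 \<le> a" "a < d" for a
  proof -
    let ?g = "\<lambda>b. pd i f (x + a *\<^sub>R axis i 1 + b *\<^sub>R axis j 1) - b *\<^sub>R D"
    let ?g' = "\<lambda>b. pd j (pd i f) (x + a *\<^sub>R axis i 1 + b *\<^sub>R axis j 1) - D"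
    have "norm (?g t - ?g 0) \<le> e * norm (t - 0)"
    proof (rule differentiable_bound[of "{0..t}" ?g "\<lambda>b h. h *\<^sub>R ?g' b"])
      fix b assume b: "b \<in> {0..t}"
      have "(?g has_vector_derivative ?g' b) (at b)"
        using b d a smooth[OF in_ball[of a b]]
        by (auto intro!: derivative_eq_intros has_vector_derivative_pd_line)
      then show "(?g has_derivative (\<lambda>h. h *\<^sub>R ?g' b)) (at b within {0..t})"
        by (simp add: has_vector_derivative_def has_derivative_at_withinI)
      show "onorm (\<lambda>h. h *\<^sub>R ?g' b) \<le> e"
        using bound[OF in_ball[of a b]] b d a by (intro onorm_scaleR_right_le) auto
    qed (use d in auto)
    then show ?thesis using d by (simp add: algebra_simps)
  qed
  let ?h = "\<lambda>a. f (x + a *\<^sub>R axis i 1 + t *\<^sub>R axis j 1) - f (x + a *\<^sub>R axis i 1) - (a * t) *\<^sub>R D"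
  let ?h' = "\<lambda>a. pd i f (x + a *\<^sub>R axis i 1 + t *\<^sub>R axis j 1) - pd i f (x + a *\<^sub>R axis i 1) - t *\<^sub>R D"
  have "norm (?h s - ?h 0) \<le> (e * t) * norm (s - 0)"
  proof (rule differentiable_bound[of "{0..s}" ?h "\<lambda>b h. h *\<^sub>R ?h' b"])
    fix b assume b: "b \<in> {0..s}"
    have eq: "x + b *\<^sub>R axis i 1 + t *\<^sub>R axis j 1 = (x + t *\<^sub>R axis j 1) + b *\<^sub>R axis i 1" for b
      by simp
    have "((\<lambda>b. f ((x + t *\<^sub>R axis j 1) + b *\<^sub>R axis i 1)) has_vector_derivative
        pd i f ((x + t *\<^sub>R axis j 1) + b *\<^sub>R axis i 1)) (at b)"
      using b d smooth[OF in_ball[of b t]] by (intro has_vector_derivative_pd_line) (simp add: eq)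
    then have 1: "((\<lambda>b. f (x + b *\<^sub>R axis i 1 + t *\<^sub>R axis j 1)) has_vector_derivative
        pd i f (x + b *\<^sub>R axis i 1 + t *\<^sub>R axis j 1)) (at b)"
      unfolding eq .
    have 2: "((\<lambda>b. f (x + b *\<^sub>R axis i 1)) has_vector_derivative pd i f (x + b *\<^sub>R axis i 1)) (at b)"
      using b d smooth[OF in_ball[of b 0]] by (intro has_vector_derivative_pd_line) auto
    have "(?h has_vector_derivative ?h' b) (at b)"
      by (intro has_vector_derivative_diff[OF has_vector_derivative_diff[OF 1 2]])
        (auto intro!: derivative_eq_intros)
    then show "(?h has_derivative (\<lambda>h. h *\<^sub>R ?h' b)) (at b within {0..s})"
      by (simp add: has_vector_derivative_def has_derivative_at_withinI)
    show "onorm (\<lambda>h. h *\<^sub>R ?h' b) \<le> e * t"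
      using inner[of b] b d by (intro onorm_scaleR_right_le) auto
  qed (use d in auto)
  then show ?thesis using d by (simp add: algebra_simps)
qed

lemma pd_commute:
  fixes f :: "real^'n::finite \<Rightarrow> complex"
  assumes "open U" "smooth_on U f" "x \<in> U"
  shows "pd i (pd j f) x = pd j (pd i f) x"
proof -
  have diff: "iter_pd is f differentiable (at y)" if "y \<in> U" for "is" y
    using assms(1,2) that by (simp add: smooth_on_iff_differentiable_at)
  have "cmod (pd j (pd i f) x - pd i (pd j f) x) \<le> e" if "e > 0" for e
  proof -
    have "isCont (pd j (pd i f)) x" "isCont (pd i (pd j f)) x"
      using smooth_on_imp_continuous_on[OF assms(2), of "[j, i]"]
        smooth_on_imp_continuous_on[OF assms(2), of "[i, j]"] assms(1,3)
      by (simp_all add: continuous_on_eq_continuous_at)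
    then have "\<exists>d>0. \<forall>y. dist y x < d \<longrightarrow> dist (pd j (pd i f) y) (pd j (pd i f) x) < e/2"
      "\<exists>d>0. \<forall>y. dist y x < d \<longrightarrow> dist (pd i (pd j f) y) (pd i (pd j f) x) < e/2"
      using \<open>e > 0\<close> half_gt_zero unfolding continuous_at_eps_delta by blast+
    then obtain d1 d2 where d1: "d1 > 0" "\<And>y. dist y x < d1 \<Longrightarrow> dist (pd j (pd i f) y) (pd j (pd i f) x) < e/2"
      and d2: "d2 > 0" "\<And>y. dist y x < d2 \<Longrightarrow> dist (pd i (pd j f) y) (pd i (pd j f) x) < e/2"
      by metis
    obtain d3 where d3: "d3 > 0" "ball x d3 \<subseteq> U" using assms(1,3) open_contains_ball by blast
    \<comment> \<open>Halved because \<open>second_difference_bound\<close> needs its hypotheses on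
      the ball of radius \<open>2 * d\<close>.\<close>
    define d where "d = min (min d1 d2) d3 / 2"
    have d: "d > 0" "2 * d \<le> d1" "2 * d \<le> d2" "ball x (2 * d) \<subseteq> U"
      using d1 d2 d3 by (auto simp: d_def)
    let ?s = "d / 2"
    let ?\<Delta> = "f (x + ?s *\<^sub>R axis i 1 + ?s *\<^sub>R axis j 1) - f (x + ?s *\<^sub>R axis i 1) - f (x + ?s *\<^sub>R axis j 1) + f x"
    have 1: "cmod (?\<Delta> - (?s * ?s) *\<^sub>R pd j (pd i f) x) \<le> e/2 * ?s * ?s"
    proof (rule second_difference_bound[where d = d])
      fix y assume y: "y \<in> ball x (2 * d)"
      then have "y \<in> U" using d by blast
      then show "f differentiable (at y) \<and> pd i f differentiable (at y)"
        using diff[of y "[]"] diff[of y "[i]"] by simp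
      have "dist y x < d1" using y d by (simp add: dist_commute)
      from d1(2)[OF this] show "cmod (pd j (pd i f) y - pd j (pd i f) x) \<le> e/2"
        by (simp add: dist_norm)
    qed (use d in auto)
    have "cmod (f (x + ?s *\<^sub>R axis j 1 + ?s *\<^sub>R axis i 1) - f (x + ?s *\<^sub>R axis j 1) - f (x + ?s *\<^sub>R axis i 1) + f x
       - (?s * ?s) *\<^sub>R pd i (pd j f) x) \<le> e/2 * ?s * ?s"
    proof (rule second_difference_bound[where d = d])
      fix y assume y: "y \<in> ball x (2 * d)"
      then have "y \<in> U" using d by blast
      then show "f differentiable (at y) \<and> pd j f differentiable (at y)"
        using diff[of y "[]"] diff[of y "[j]"] by simp
      have "dist y x < d2" using y d by (simp add: dist_commute)
      from d2(2)[OF this] show "cmod (pd i (pd j f) y - pd i (pd j f) x) \<le> e/2"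
        by (simp add: dist_norm)
    qed (use d in auto)
    then have 2: "cmod (?\<Delta> - (?s * ?s) *\<^sub>R pd i (pd j f) x) \<le> e/2 * ?s * ?s"
      by (simp add: algebra_simps)
    have "(?s * ?s) * cmod (pd j (pd i f) x - pd i (pd j f) x)
       = cmod ((?s * ?s) *\<^sub>R (pd j (pd i f) x - pd i (pd j f) x))"
      using d by (simp only: norm_scaleR) simp
    also have "\<dots> = cmod ((?\<Delta> - (?s * ?s) *\<^sub>R pd i (pd j f) x) - (?\<Delta> - (?s * ?s) *\<^sub>R pd j (pd i f) x))"
      by (simp add: algebra_simps)
    also have "\<dots> \<le> (?s * ?s) * e"
      using order_trans[OF norm_triangle_ineq4 add_mono[OF 2 1]] by (simp add: mult_ac)
    finally show ?thesis using d by simp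
  qed
  then have "cmod (pd j (pd i f) x - pd i (pd j f) x) \<le> 0" by (rule field_le_epsilon) simp
  then show ?thesis by simp
qed

text \<open>The head of \<open>is\<close> occurs somewhere in \<open>js\<close> and is moved to the
  front by adjacent swaps, each an instance of \<open>pd_commute\<close>. The point stays arbitrary
  in the induction because \<open>pd\<close> needs equality on a whole neighbourhood.\<close>

lemma iter_pd_mset_cong:
  fixes f :: "real^'n::finite \<Rightarrow> complex"
  assumes "open U" "smooth_on U f" "x \<in> U" "mset is = mset js"
  shows "iter_pd is f x = iter_pd js f x"
  using assms(3,4)
proof (induction "is" arbitrary: js x)
  case (Cons i "is")
  have move: "iter_pd (as @ i # bs) f x = iter_pd (i # as @ bs) f x" if "x \<in> U" for as bs x
    using that
  proof (induction as arbitrary: x)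
    case (Cons a as)
    have "iter_pd ((a # as) @ i # bs) f x = pd a (iter_pd (i # as @ bs) f) x"
      using pd_cong[OF assms(1) Cons.prems Cons.IH] by simp
    also have "\<dots> = pd i (pd a (iter_pd (as @ bs) f)) x"
      using pd_commute[OF assms(1) smooth_on_iter_pd[OF assms(2)] Cons.prems] by simp
    finally show ?case by simp
  qed simp
  from Cons.prems(2) have "i \<in> set js" by (metis list.set_intros(1) set_mset_mset)
  then obtain as bs where js: "js = as @ i # bs" by (meson split_list)
  then have "mset is = mset (as @ bs)" using Cons.prems(2) by simp
  then have "pd i (iter_pd is f) x = pd i (iter_pd (as @ bs) f) x"
    using Cons by (intro pd_cong[OF assms(1)])
  then show ?case using move[OF Cons.prems(1)] js by simp
qed simp

section \<open>Multi-indices represented by lists of directions\<close>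

lemma mset_eqI_count_list:
  assumes "\<And>i. count_list is i = count_list js i"
  shows "mset is = mset js"
  by (rule multiset_eqI) (simp only: assms count_mset)

lemma ex_list_count: "\<exists>is. \<forall>i::'n::finite. count_list is i = \<alpha> i"
proof -
  obtain "is" where "mset is = (\<Sum>j\<in>UNIV. replicate_mset (\<alpha> j) j)" using ex_mset by blast
  then have "count_list is i = \<alpha> i" for i
    by (simp add: count_sum flip: count_mset)
  then show ?thesis by blast
qed

lemma mpd_eq_iter_pd:
  fixes f :: "real^'n::finite \<Rightarrow> complex"
  assumes "open U" "smooth_on U f" "x \<in> U"
  shows "mpd (count_list is) f x = iter_pd is f x"
proof -
  have "\<exists>js. \<forall>i. count_list js i = count_list is i" by blast
  from someI_ex[OF this] show ?thesis
    unfolding mpd_def by (intro iter_pd_mset_cong[OF assms] mset_eqI_count_list) blast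
qed

lemma mi_abs_count_list: "mi_abs (count_list is) = length (is :: 'n::finite list)"
  unfolding mi_abs_def by (rule sum_count_set) simp_all

text \<open>Bounds over all multi-indices can thus be proved for lists, where the recursion of
  \<open>iter_pd\<close> and induction are available.\<close>

lemma all_multi_index_iff:
  "(\<forall>\<alpha>::'n::finite \<Rightarrow> nat. P \<alpha>) \<longleftrightarrow> (\<forall>is. P (count_list is))"
proof (intro iffI allI)
  fix \<alpha> :: "'n \<Rightarrow> nat"
  assume *: "\<forall>is. P (count_list is)"
  obtain "is" where "\<forall>i. count_list is i = \<alpha> i" using ex_list_count[of \<alpha>] ..
  then have "count_list is = \<alpha>" by (intro ext) (rule spec)
  with spec[OF *, of "is"] show "P \<alpha>" by simp
next
  show "P (count_list is)" if "\<forall>\<alpha>. P \<alpha>" for "is" using that by (rule spec)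
qed

lemma mpd_cong:
  assumes "open U" "x \<in> U" "\<And>y. y \<in> U \<Longrightarrow> f y = g y"
  shows "mpd \<alpha> f x = mpd \<alpha> g x"
  unfolding mpd_def using assms by (rule iter_pd_cong)

lemma mpd_linear_combination:
  assumes "open U" "smooth_on U f" "smooth_on U g" "x \<in> U"
  shows "mpd \<alpha> (\<lambda>x. c * f x + d * g x) x = c * mpd \<alpha> f x + d * mpd \<alpha> g x"
  unfolding mpd_def using assms by (rule iter_pd_linear_combination)

lemma continuous_on_mpd: "smooth_on U f \<Longrightarrow> continuous_on U (mpd \<alpha> f)"
  unfolding mpd_def by (rule smooth_on_imp_continuous_on)


section \<open>Compactness\<close>

text \<open>The source of equicontinuity: bounds one order higher control the oscillation. Balls
  serve as the convex sets that the mean value inequality needs; the constant does not depend on the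
  ball.\<close>

lemma iter_pd_lipschitz:
  fixes f :: "real^'n::finite \<Rightarrow> complex"
  assumes "open U" "smooth_on U f" "ball x e \<subseteq> U"
    and B: "\<And>i y. y \<in> U \<Longrightarrow> cmod (iter_pd (i # is) f y) \<le> B i"
    and "y \<in> ball x e" "z \<in> ball x e"
  shows "cmod (iter_pd is f y - iter_pd is f z) \<le> (\<Sum>i\<in>UNIV. B i) * norm (y - z)"
proof (rule differentiable_bound[OF convex_ball])
  fix w assume "w \<in> ball x e"
  then have w: "w \<in> U" using assms(3) by blast
  let ?D = "\<lambda>v. \<Sum>i\<in>UNIV. (v $ i) *\<^sub>R iter_pd (i # is) f w"
  have "iter_pd is f differentiable (at w)"
    using assms(1,2) w smooth_on_iff_differentiable_at by blast
  from has_derivative_pd[OF this] show "(iter_pd is f has_derivative ?D) (at w within ball x e)"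
    unfolding iter_pd.simps by (rule has_derivative_at_withinI)
  show "onorm ?D \<le> (\<Sum>i\<in>UNIV. B i)"
  proof (rule onorm_le)
    fix v :: "real^'n"
    have "norm (?D v) \<le> (\<Sum>i\<in>UNIV. norm v * B i)"
    proof (rule sum_norm_le)
      fix i
      show "norm ((v $ i) *\<^sub>R iter_pd (i # is) f w) \<le> norm v * B i"
        unfolding norm_scaleR using component_le_norm_cart[of v i] B[OF w, of i]
        by (intro mult_mono) auto
    qed
    also have "\<dots> = norm v * (\<Sum>i\<in>UNIV. B i)"
      by (simp only: sum_distrib_left)
    finally show "norm (?D v) \<le> (\<Sum>i\<in>UNIV. B i) * norm v" by (simp only: mult.commute)
  qed
qed (use assms in auto)

text \<open>One diagonal selection treats all derivatives at once, on the countable set of pairs of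
  a dense point and a list. Equicontinuity extends the convergence to \<open>U\<close>, uniformly on
  compact sets, and only then are the limits identified as derivatives of one function.\<close>

theorem smooth_bounded_subsequence:
  fixes f :: "nat \<Rightarrow> real^'n::finite \<Rightarrow> complex"
  assumes U: "open U" and smooth: "\<And>n. smooth_on U (f n)"
    and B: "\<And>n is x. x \<in> U \<Longrightarrow> cmod (iter_pd is (f n) x) \<le> B is"
  obtains k g where "strict_mono k" "smooth_on U g"
    "\<And>is C. compact C \<Longrightarrow> C \<subseteq> U \<Longrightarrow>
      uniform_limit C (\<lambda>n. iter_pd is (f (k n))) (iter_pd is g) sequentially"
proof -
  obtain D :: "(real^'n) set" where "countable D"
    and D: "\<And>X. open X \<Longrightarrow> X \<noteq> {} \<Longrightarrow> \<exists>d\<in>D. d \<in> X"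
    using countable_dense_exists by blast
  \<comment> \<open>Normalised, since the diagonal lemma asks for one bound common to all pairs,
    while \<open>B\<close> depends on the list.\<close>
  define F where "F n p = iter_pd (snd p) (f n) (fst p) / of_real (\<bar>B (snd p)\<bar> + 1)" for n p
  have "countable (UNIV :: 'n list set)"
    using countable_lists[of "UNIV :: 'n set"] by simp
  then have cS: "countable ((D \<inter> U) \<times> (UNIV :: 'n list set))"
    using \<open>countable D\<close> by blast
  have bd: "norm (F n p) \<le> 1" if "p \<in> (D \<inter> U) \<times> UNIV" for n p
  proof -
    have "cmod (iter_pd (snd p) (f n) (fst p)) \<le> \<bar>B (snd p)\<bar> + 1"
      using B[of "fst p" "snd p" n] that by fastforce
    then show ?thesis unfolding F_def norm_divide norm_of_real by simp
  qed
  obtain k where k: "strict_mono k"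
    and conv: "\<And>p. p \<in> (D \<inter> U) \<times> UNIV \<Longrightarrow> \<exists>l. (\<lambda>n. F (k n) p) \<longlonglongrightarrow> l"
    using function_convergent_subsequence[where f = F, OF cS bd] by metis
  let ?f = "\<lambda>n is. iter_pd is (f (k n))"
  have conv_D: "Cauchy (\<lambda>n. ?f n is d)" if d: "d \<in> D" "d \<in> U" for d "is"
  proof -
    obtain l where "(\<lambda>n. F (k n) (d, is)) \<longlonglongrightarrow> l" using conv[of "(d, is)"] d by blast
    then have "(\<lambda>n. F (k n) (d, is) * of_real (\<bar>B is\<bar> + 1)) \<longlonglongrightarrow> l * of_real (\<bar>B is\<bar> + 1)"
      by (intro tendsto_intros)
    moreover have "F (k n) (d, is) * of_real (\<bar>B is\<bar> + 1) = ?f n is d" for n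
    proof -
      have "complex_of_real (\<bar>B is\<bar> + 1) \<noteq> 0" unfolding of_real_eq_0_iff by linarith
      then show ?thesis unfolding F_def by simp
    qed
    ultimately show ?thesis by (simp add: LIMSEQ_imp_Cauchy)
  qed
  \<comment> \<open>The summand 1 makes the Lipschitz constant positive, so that it can be divided
    by below.\<close>
  define L where "L is = (\<Sum>i\<in>UNIV. \<bar>B (i # is)\<bar>) + 1" for "is"
  have L: "L is > 0" for "is"
  proof -
    have "(\<Sum>i\<in>UNIV. \<bar>B (i # is)\<bar>) \<ge> 0" by (rule sum_nonneg) simp
    then show ?thesis unfolding L_def by linarith
  qed
  have lip: "cmod (?f n is y - ?f n is z) \<le> L is * norm (y - z)"
    if "ball x e \<subseteq> U" "y \<in> ball x e" "z \<in> ball x e" for n "is" x e y z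
  proof -
    have "cmod (?f n is y - ?f n is z) \<le> (\<Sum>i\<in>UNIV. \<bar>B (i # is)\<bar>) * norm (y - z)"
      by (rule iter_pd_lipschitz[OF U smooth that(1) _ that(2,3)]) (rule order_trans[OF B abs_ge_self])
    also have "\<dots> \<le> L is * norm (y - z)" unfolding L_def by (intro mult_right_mono) auto
    finally show ?thesis .
  qed
  have conv_U: "convergent (\<lambda>n. ?f n is x)" if x: "x \<in> U" for x "is"
  proof (rule Cauchy_convergent, rule metric_CauchyI)
    fix \<epsilon> :: real assume \<epsilon>: "\<epsilon> > 0"
    obtain e where e: "e > 0" "ball x e \<subseteq> U" using U x open_contains_ball by blast
    define \<eta> where "\<eta> = min e (\<epsilon> / (3 * L is))"
    have \<eta>: "\<eta> > 0" "\<eta> \<le> e" using e \<epsilon> L[of "is"] by (auto simp: \<eta>_def)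
    have L\<eta>: "L is * \<eta> \<le> \<epsilon> / 3"
      using mult_left_mono[of \<eta> "\<epsilon> / (3 * L is)" "L is"] L[of "is"] by (simp add: \<eta>_def)
    obtain d where d: "d \<in> D" "d \<in> ball x \<eta>" using D[of "ball x \<eta>"] \<eta> by auto
    have de: "d \<in> ball x e" using d \<eta> by auto
    then have "d \<in> U" using e by blast
    from metric_CauchyD[OF conv_D[OF d(1) this]] \<epsilon> obtain N where
      N: "\<And>m n. m \<ge> N \<Longrightarrow> n \<ge> N \<Longrightarrow> dist (?f m is d) (?f n is d) < \<epsilon> / 3"
      by (metis divide_pos_pos zero_less_numeral)
    have near: "dist (?f n is x) (?f n is d) \<le> \<epsilon> / 3" for n
    proof -
      have "dist (?f n is x) (?f n is d) \<le> L is * norm (x - d)"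
        unfolding dist_norm using lip[OF e(2) _ de] e by simp
      also have "\<dots> \<le> L is * \<eta>"
        using d L[of "is"] by (intro mult_left_mono) (auto simp: dist_norm)
      finally show ?thesis using L\<eta> by linarith
    qed
    show "\<exists>N. \<forall>m\<ge>N. \<forall>n\<ge>N. dist (?f m is x) (?f n is x) < \<epsilon>"
    proof (intro exI allI impI)
      fix m n assume "N \<le> m" "N \<le> n"
      then have "dist (?f m is d) (?f n is d) < \<epsilon> / 3" by (rule N)
      then show "dist (?f m is x) (?f n is x) < \<epsilon>"
        using near[of m] near[of n] dist_triangle[of "?f m is x" "?f n is x" "?f m is d"]
          dist_triangle[of "?f m is d" "?f n is x" "?f n is d"]
        by (simp add: dist_commute)
    qed
  qed
  \<comment> \<open>Each list has its own limit; nothing yet relates \<open>G (i # is)\<close> to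
    \<open>G is\<close>.\<close>
  define G where "G is x = lim (\<lambda>n. ?f n is x)" for "is" x
  have G: "(\<lambda>n. ?f n is x) \<longlonglongrightarrow> G is x" if "x \<in> U" for x "is"
    using conv_U[OF that] unfolding G_def convergent_LIMSEQ_iff by blast
  have lip_G: "cmod (G is y - G is z) \<le> L is * norm (y - z)"
    if "ball x e \<subseteq> U" "y \<in> ball x e" "z \<in> ball x e" for "is" x e y z
  proof (rule LIMSEQ_le_const2)
    show "(\<lambda>n. cmod (?f n is y - ?f n is z)) \<longlonglongrightarrow> cmod (G is y - G is z)"
      using that by (intro tendsto_intros G) blast+
    show "\<exists>N. \<forall>n\<ge>N. cmod (?f n is y - ?f n is z) \<le> L is * norm (y - z)"
      using lip[OF that] by blast
  qed
  have unif: "uniform_limit C (\<lambda>n. ?f n is) (G is) sequentially" if C: "compact C" "C \<subseteq> U" for C "is"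
  proof (rule uniform_limitI)
    fix \<epsilon> :: real assume \<epsilon>: "\<epsilon> > 0"
    obtain \<delta> where \<delta>: "\<delta> > 0" "(\<Union>x\<in>C. ball x \<delta>) \<subseteq> U"
      using compact_subset_open_imp_ball_epsilon_subset[OF C(1) U C(2)] by blast
    define \<eta> where "\<eta> = min \<delta> (\<epsilon> / (3 * L is))"
    have \<eta>: "\<eta> > 0" "\<eta> \<le> \<delta>" using \<delta> \<epsilon> L[of "is"] by (auto simp: \<eta>_def)
    have L\<eta>: "L is * \<eta> \<le> \<epsilon> / 3"
      using mult_left_mono[of \<eta> "\<epsilon> / (3 * L is)" "L is"] L[of "is"] by (simp add: \<eta>_def)
    have "C \<subseteq> (\<Union>x\<in>C. ball x \<eta>)" using \<eta> by auto
    then obtain T where T: "T \<subseteq> C" "finite T" "C \<subseteq> (\<Union>x\<in>T. ball x \<eta>)"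
      using compactE_image[OF C(1), of C "\<lambda>x. ball x \<eta>"] by auto
    have "\<forall>\<^sub>F n in sequentially. \<forall>t\<in>T. dist (?f n is t) (G is t) < \<epsilon> / 3"
    proof (rule eventually_ball_finite[OF T(2)], rule ballI)
      fix t assume "t \<in> T"
      then have "t \<in> U" using T C by blast
      from tendstoD[OF G[OF this], of "\<epsilon> / 3"] \<epsilon>
      show "\<forall>\<^sub>F n in sequentially. dist (?f n is t) (G is t) < \<epsilon> / 3" by auto
    qed
    then show "\<forall>\<^sub>F n in sequentially. \<forall>x\<in>C. dist (?f n is x) (G is x) < \<epsilon>"
    proof eventually_elim
      case (elim n)
      show ?case
      proof
        fix x assume "x \<in> C"
        then obtain t where t: "t \<in> T" "x \<in> ball t \<eta>" using T by blast
        have ball: "ball t \<delta> \<subseteq> U" using t T \<delta> by blast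
        have xt: "x \<in> ball t \<delta>" "t \<in> ball t \<delta>" using t \<eta> \<delta> by auto
        have "L is * norm (x - t) \<le> L is * \<eta>"
          using t L[of "is"] by (intro mult_left_mono) (auto simp: dist_norm norm_minus_commute)
        then have "cmod (?f n is x - ?f n is t) \<le> \<epsilon> / 3" "cmod (G is x - G is t) \<le> \<epsilon> / 3"
          using lip[OF ball xt, of "is" n] lip_G[OF ball xt, of "is"] L\<eta> by linarith+
        moreover have "dist (?f n is t) (G is t) < \<epsilon> / 3" using elim t by blast
        ultimately show "dist (?f n is x) (G is x) < \<epsilon>"
          using dist_triangle[of "?f n is x" "G is x" "?f n is t"]
            dist_triangle[of "?f n is t" "G is x" "G is t"]
          by (simp add: dist_norm norm_minus_commute)
      qed
    qed
  qed
  \<comment> \<open>Limit and differentiation are interchanged on a ball whose closure is compact in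
    \<open>U\<close>, where the differentials converge uniformly. The resulting limit
    \<open>g\<close> is only known to exist; uniqueness of pointwise limits identifies it with
    \<open>G is\<close>.\<close>
  have deriv_G: "(G is has_derivative (\<lambda>v. \<Sum>i\<in>UNIV. (v $ i) *\<^sub>R G (i # is) x)) (at x)"
    if x: "x \<in> U" for x "is"
  proof -
    obtain e where e: "e > 0" "cball x e \<subseteq> U" using U x open_contains_cball by blast
    let ?S = "ball x e"
    have SU: "y \<in> U" if "y \<in> ?S" for y using e that by auto
    have "\<exists>g. \<forall>y\<in>?S. (\<lambda>n. ?f n is y) \<longlonglongrightarrow> g y \<and>
      (g has_derivative (\<lambda>v. \<Sum>i\<in>UNIV. (v $ i) *\<^sub>R G (i # is) y)) (at y within ?S)"
    proof (rule has_derivative_sequence)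
      show "convex ?S" by simp
      show "(?f n is has_derivative (\<lambda>v. \<Sum>i\<in>UNIV. (v $ i) *\<^sub>R ?f n (i # is) y)) (at y within ?S)"
        if "y \<in> ?S" for n y
      proof -
        have "?f n is differentiable (at y)"
          using U smooth SU[OF that] smooth_on_iff_differentiable_at by blast
        from has_derivative_pd[OF this] show ?thesis
          unfolding iter_pd.simps by (rule has_derivative_at_withinI)
      qed
      show "\<forall>\<^sub>F n in sequentially. \<forall>y\<in>?S. \<forall>v. norm ((\<Sum>i\<in>UNIV. (v $ i) *\<^sub>R ?f n (i # is) y) -
          (\<Sum>i\<in>UNIV. (v $ i) *\<^sub>R G (i # is) y)) \<le> \<epsilon> * norm v"
        if \<epsilon>: "\<epsilon> > 0" for \<epsilon>
      proof -
        \<comment> \<open>The differential is a sum over the coordinates, so their number divides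
          the tolerance.\<close>
        let ?\<epsilon> = "\<epsilon> / real CARD('n)"
        have "\<forall>\<^sub>F n in sequentially. \<forall>i\<in>UNIV. \<forall>y\<in>cball x e. dist (?f n (i # is) y) (G (i # is) y) < ?\<epsilon>"
          by (rule eventually_ball_finite, simp, intro ballI uniform_limitD[OF unif[OF compact_cball e(2)]])
            (use \<epsilon> in simp)
        then show ?thesis
        proof eventually_elim
          case (elim n)
          show ?case
          proof (intro ballI allI)
            fix y and v :: "real^'n" assume y: "y \<in> ?S"
            have "norm ((\<Sum>i\<in>UNIV. (v $ i) *\<^sub>R ?f n (i # is) y) - (\<Sum>i\<in>UNIV. (v $ i) *\<^sub>R G (i # is) y))
              = norm (\<Sum>i\<in>UNIV. (v $ i) *\<^sub>R (?f n (i # is) y - G (i # is) y))"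
              by (simp only: sum_subtractf scaleR_diff_right)
            also have "\<dots> \<le> (\<Sum>i\<in>(UNIV::'n set). norm v * ?\<epsilon>)"
            proof (rule sum_norm_le)
              fix i
              have "norm (?f n (i # is) y - G (i # is) y) \<le> ?\<epsilon>"
                using elim y unfolding dist_norm[symmetric] by (meson UNIV_I ball_subset_cball less_imp_le subsetD)
              then show "norm ((v $ i) *\<^sub>R (?f n (i # is) y - G (i # is) y)) \<le> norm v * ?\<epsilon>"
                unfolding norm_scaleR using component_le_norm_cart[of v i] by (intro mult_mono) auto
            qed
            also have "\<dots> = \<epsilon> * norm v" by simp
            finally show "norm ((\<Sum>i\<in>UNIV. (v $ i) *\<^sub>R ?f n (i # is) y) -
              (\<Sum>i\<in>UNIV. (v $ i) *\<^sub>R G (i # is) y)) \<le> \<epsilon> * norm v" .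
          qed
        qed
      qed
      show "x \<in> ?S" using e by simp
      show "(\<lambda>n. ?f n is x) \<longlonglongrightarrow> G is x" using G x .
    qed
    then obtain g where g: "\<And>y. y \<in> ?S \<Longrightarrow> (\<lambda>n. ?f n is y) \<longlonglongrightarrow> g y"
      "\<And>y. y \<in> ?S \<Longrightarrow> (g has_derivative (\<lambda>v. \<Sum>i\<in>UNIV. (v $ i) *\<^sub>R G (i # is) y)) (at y within ?S)"
      by blast
    have xS: "x \<in> ?S" using e by simp
    have "(g has_derivative (\<lambda>v. \<Sum>i\<in>UNIV. (v $ i) *\<^sub>R G (i # is) x)) (at x)"
      using g(2)[OF xS] unfolding at_within_open[OF xS open_ball] .
    then show ?thesis
    proof (rule has_derivative_transform_within_open[OF _ open_ball xS])
      show "g y = G is y" if "y \<in> ?S" for y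
        using LIMSEQ_unique[OF g(1)[OF that] G[OF SU[OF that]]] .
    qed
  qed
  have iter_G: "iter_pd is (G []) x = G is x" if "x \<in> U" for "is" x
    using that
  proof (induction "is" arbitrary: x)
    case (Cons i "is")
    have "pd i (iter_pd is (G [])) x = pd i (G is) x"
      by (rule pd_cong[OF U Cons.prems Cons.IH])
    also have "\<dots> = (\<Sum>j\<in>UNIV. (axis i 1 $ j) *\<^sub>R G (j # is) x)"
      by (rule pd_eqI[OF deriv_G[OF Cons.prems]])
    also have "\<dots> = (\<Sum>j\<in>UNIV. if j = i then G (j # is) x else 0)"
      by (intro sum.cong) (simp_all add: axis_def)
    finally show ?case by simp
  qed simp
  have "smooth_on U (G [])"
    unfolding smooth_on_iff_differentiable_at[OF U]
  proof (intro allI ballI)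
    fix "is" x assume x: "x \<in> U"
    have "(iter_pd is (G []) has_derivative (\<lambda>v. \<Sum>i\<in>UNIV. (v $ i) *\<^sub>R G (i # is) x)) (at x)"
      by (rule has_derivative_transform_within_open[OF deriv_G[OF x] U x]) (simp only: iter_G)
    then show "iter_pd is (G []) differentiable (at x)" unfolding differentiable_def by blast
  qed
  moreover have "uniform_limit C (\<lambda>n. ?f n is) (iter_pd is (G [])) sequentially"
    if "compact C" "C \<subseteq> U" for C "is"
    using unif[OF that, of "is"]
    by (rule uniform_limit_cong'[THEN iffD1, rotated 2]) (use that in \<open>simp_all add: iter_G subset_iff\<close>)
  ultimately show ?thesis using k that by blast
qed

text \<open>The loss from \<open>h\<close> to \<open>2 * h\<close> makes the high-order derivatives negligible, so that uniform
  convergence of finitely many derivatives suffices.\<close>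

lemma weighted_bounded_subsequence:
  fixes f :: "nat \<Rightarrow> real^'n::finite \<Rightarrow> complex"
  assumes U: "open U" and smooth: "\<And>n. smooth_on U (f n)"
    and M: "\<And>p. M p > 0" and "h > 0"
    and B: "\<And>n is x. x \<in> U \<Longrightarrow> cmod (iter_pd is (f n) x) \<le> C * h ^ length is * M (length is)"
  obtains k g where "strict_mono k" "smooth_on U g"
    "\<And>is x. x \<in> U \<Longrightarrow> (\<lambda>n. iter_pd is (f (k n)) x) \<longlonglongrightarrow> iter_pd is g x"
    "\<And>K \<epsilon>. compact K \<Longrightarrow> K \<subseteq> U \<Longrightarrow> \<epsilon> > 0 \<Longrightarrow> \<forall>\<^sub>F n in sequentially. \<forall>is. \<forall>x\<in>K.
      cmod (iter_pd is (f (k n)) x - iter_pd is g x) \<le> \<epsilon> * (2 * h) ^ length is * M (length is)"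
proof -
  obtain k g where k: "strict_mono k" and g: "smooth_on U g"
    and unif: "\<And>is K. compact K \<Longrightarrow> K \<subseteq> U \<Longrightarrow>
      uniform_limit K (\<lambda>n. iter_pd is (f (k n))) (iter_pd is g) sequentially"
    using smooth_bounded_subsequence[where f = f, OF U smooth B] by metis
  have lim: "(\<lambda>n. iter_pd is (f (k n)) x) \<longlonglongrightarrow> iter_pd is g x" if "x \<in> U" for "is" x
    using tendsto_uniform_limitI[OF unif[of "{x}" "is"]] that by simp
  have Bg: "cmod (iter_pd is g x) \<le> C * h ^ length is * M (length is)" if "x \<in> U" for "is" x
    using LIMSEQ_le_const2[OF tendsto_norm[OF lim[OF that]]] B[OF that] by blast
  have "\<forall>\<^sub>F n in sequentially. \<forall>is. \<forall>x\<in>K.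
      cmod (iter_pd is (f (k n)) x - iter_pd is g x) \<le> \<epsilon> * (2 * h) ^ length is * M (length is)"
    if K: "compact K" "K \<subseteq> U" and \<epsilon>: "\<epsilon> > 0" for K \<epsilon>
  proof -
    \<comment> \<open>Above order \<open>N\<close> the crude bound
      \<open>2 * C * h ^ p * M p\<close> for the difference is already small enough; only finitely
      many lists remain below.\<close>
    obtain N where N: "2 * C / \<epsilon> < 2 ^ N" using real_arch_pow[of 2 "2 * C / \<epsilon>"] by auto
    have fin: "finite {is :: 'n list. length is \<le> N}"
      using finite_lists_length_le[of "UNIV :: 'n set" N] by simp
    have "\<forall>\<^sub>F n in sequentially. \<forall>is\<in>{is. length is \<le> N}. \<forall>x\<in>K.
        dist (iter_pd is (f (k n)) x) (iter_pd is g x) < \<epsilon> * (2 * h) ^ length is * M (length is)"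
      by (intro eventually_ball_finite[OF fin] ballI uniform_limitD[OF unif[OF K]])
        (use \<epsilon> \<open>h > 0\<close> M in simp)
    then show ?thesis
    proof eventually_elim
      case (elim n)
      show ?case
      proof (intro allI ballI)
        fix "is" x assume x: "x \<in> K"
        show "cmod (iter_pd is (f (k n)) x - iter_pd is g x) \<le> \<epsilon> * (2 * h) ^ length is * M (length is)"
        proof (cases "length is \<le> N")
          case True
          with elim x show ?thesis unfolding dist_norm by (auto intro: less_imp_le)
        next
          case False
          have "2 * C / \<epsilon> \<le> 2 ^ length is"
            using N power_increasing[of N "length is" "2::real"] False by linarith
          then have "2 * C \<le> \<epsilon> * 2 ^ length is" using \<epsilon> by (simp add: field_simps)
          then have *: "2 * C * (h ^ length is * M (length is)) \<le> \<epsilon> * 2 ^ length is * (h ^ length is * M (length is))"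
            using \<open>h > 0\<close> M[of "length is"] by (intro mult_right_mono) auto
          have "cmod (iter_pd is (f (k n)) x - iter_pd is g x) \<le> 2 * C * (h ^ length is * M (length is))"
            using norm_triangle_ineq4[of "iter_pd is (f (k n)) x" "iter_pd is g x"]
              B[of x "is" "k n"] Bg[of x "is"] x K by (auto simp: mult.assoc)
          also have "\<dots> \<le> \<epsilon> * (2 * h) ^ length is * M (length is)"
            using * by (simp add: power_mult_distrib mult.assoc)
          finally show ?thesis .
        qed
      qed
    qed
  qed
  with k g lim that show ?thesis by blast
qed


section \<open>Seminorms and the topologies they generate\<close>

lemma wsup_le_iff:
  assumes "\<And>p. w p > 0" "c \<ge> 0"
  shows "wsup K w D \<le> ennreal c \<longleftrightarrow> (\<forall>\<alpha>. \<forall>x\<in>K. cmod (D \<alpha> x) \<le> c * w (mi_abs \<alpha>))"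
  unfolding wsup_def SUP_le_iff using assms by (simp add: pos_divide_le_eq)

text \<open>Finiteness matters because \<open>enn2real\<close> sends infinity to 0.\<close>

lemma cmod_le_wsup:
  assumes "\<And>p. w p > 0" "wsup K w D < \<infinity>" "x \<in> K"
  shows "cmod (D \<alpha> x) \<le> enn2real (wsup K w D) * w (mi_abs \<alpha>)"
proof -
  have "wsup K w D \<le> ennreal (enn2real (wsup K w D))"
    using assms(2) by (simp add: ennreal_enn2real_if)
  then show ?thesis using assms(3) by (subst (asm) wsup_le_iff[OF assms(1) enn2real_nonneg]) blast
qed

lemma enn2real_wsup_le:
  assumes "\<And>p. w p > 0" "c \<ge> 0" "\<And>\<alpha> x. x \<in> K \<Longrightarrow> cmod (D \<alpha> x) \<le> c * w (mi_abs \<alpha>)"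
  shows "enn2real (wsup K w D) \<le> c"
  using assms by (intro enn2real_leI) (simp_all add: wsup_le_iff)

lemma wsup_less_top_iff:
  assumes "\<And>p. w p > 0"
  shows "wsup K w D < \<infinity> \<longleftrightarrow> (\<exists>c\<ge>0. \<forall>\<alpha>. \<forall>x\<in>K. cmod (D \<alpha> x) \<le> c * w (mi_abs \<alpha>))"
proof
  assume "wsup K w D < \<infinity>"
  then show "\<exists>c\<ge>0. \<forall>\<alpha>. \<forall>x\<in>K. cmod (D \<alpha> x) \<le> c * w (mi_abs \<alpha>)"
    using cmod_le_wsup[where w = w, OF assms] enn2real_nonneg by blast
next
  assume "\<exists>c\<ge>0. \<forall>\<alpha>. \<forall>x\<in>K. cmod (D \<alpha> x) \<le> c * w (mi_abs \<alpha>)"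
  then obtain c where "c \<ge> 0" "wsup K w D \<le> ennreal c"
    using wsup_le_iff[where w = w, OF assms] by blast
  then show "wsup K w D < \<infinity>"
    using ennreal_less_top order.strict_trans1 unfolding infinity_ennreal_def by blast
qed

lemma wsup_cong:
  assumes "\<And>\<alpha> x. x \<in> K \<Longrightarrow> D \<alpha> x = D' \<alpha> x"
  shows "wsup K w D = wsup K w D'"
  unfolding wsup_def using assms by simp

text \<open>\<open>D\<close> stays abstract to cover both \<open>norm_h\<close>, which uses
  \<open>ext_pd\<close>, and \<open>norm_r\<close>, which uses \<open>mpd\<close>. Both are linear
  in the function only at suitable points, so linearity is required on \<open>K\<close>
  alone.\<close>

lemma seminorm_on_wsup:
  assumes w: "\<And>p. w p > 0" and fin: "\<And>f. f \<in> V \<Longrightarrow> wsup K w (D f) < \<infinity>"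
    and lin: "\<And>f g c d \<alpha> x. f \<in> V \<Longrightarrow> g \<in> V \<Longrightarrow> x \<in> K \<Longrightarrow>
      D (\<lambda>x. c * f x + d * g x) \<alpha> x = c * D f \<alpha> x + d * D g \<alpha> x"
  shows "seminorm_on V (\<lambda>f. enn2real (wsup K w (D f)))"
  unfolding seminorm_on_def
proof (intro conjI allI ballI)
  let ?N = "\<lambda>f. enn2real (wsup K w (D f))"
  have bound: "cmod (D f \<alpha> x) \<le> ?N f * w (mi_abs \<alpha>)" if "f \<in> V" "x \<in> K" for f \<alpha> x
    by (rule cmod_le_wsup[where w = w, OF w fin[OF that(1)] that(2)])
  show "?N (\<lambda>x. f x + g x) \<le> ?N f + ?N g" if f: "f \<in> V" and g: "g \<in> V" for f g
  proof (rule enn2real_wsup_le[where w = w, OF w])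
    fix \<alpha> x assume x: "x \<in> K"
    have "D (\<lambda>x. f x + g x) \<alpha> x = D f \<alpha> x + D g \<alpha> x" using lin[OF f g x, of 1 1] by simp
    then have "cmod (D (\<lambda>x. f x + g x) \<alpha> x) \<le> cmod (D f \<alpha> x) + cmod (D g \<alpha> x)"
      by (simp add: norm_triangle_ineq)
    then show "cmod (D (\<lambda>x. f x + g x) \<alpha> x) \<le> (?N f + ?N g) * w (mi_abs \<alpha>)"
      using bound[OF f x, of \<alpha>] bound[OF g x, of \<alpha>] by (simp add: distrib_right)
  qed simp
  show "?N (\<lambda>x. c * f x) = cmod c * ?N f" if f: "f \<in> V" for c f
  proof (rule antisym)
    have scale: "cmod (D (\<lambda>x. c * f x) \<alpha> x) = cmod c * cmod (D f \<alpha> x)" if "x \<in> K" for \<alpha> x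
      using lin[OF f f that, of c 0] by (simp add: norm_mult)
    have le: "cmod (D (\<lambda>x. c * f x) \<alpha> x) \<le> cmod c * ?N f * w (mi_abs \<alpha>)" if "x \<in> K" for \<alpha> x
      using mult_left_mono[OF bound[OF f that, of \<alpha>], of "cmod c"] unfolding scale[OF that]
      by (simp add: mult.assoc)
    show "?N (\<lambda>x. c * f x) \<le> cmod c * ?N f"
      by (rule enn2real_wsup_le[where w = w, OF w]) (use le in simp_all)
    \<comment> \<open>\<open>V\<close> is not assumed to be closed under scaling, so finiteness
      comes from the bound \<open>le\<close> rather than from \<open>fin\<close>.\<close>
    have fin': "wsup K w (D (\<lambda>x. c * f x)) < \<infinity>"
      unfolding wsup_less_top_iff[where w = w, OF w] using le by (meson enn2real_nonneg mult_nonneg_nonneg norm_ge_zero)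
    show "cmod c * ?N f \<le> ?N (\<lambda>x. c * f x)"
    proof (cases "c = 0")
      case False
      have "?N f \<le> ?N (\<lambda>x. c * f x) / cmod c"
      proof (rule enn2real_wsup_le[where w = w, OF w])
        fix \<alpha> x assume x: "x \<in> K"
        show "cmod (D f \<alpha> x) \<le> ?N (\<lambda>x. c * f x) / cmod c * w (mi_abs \<alpha>)"
          using cmod_le_wsup[where w = w, OF w fin' x, of \<alpha>] False unfolding scale[OF x]
          by (simp add: field_simps)
      qed simp
      then show ?thesis using False by (simp add: field_simps)
    qed simp
  qed
qed simp

section \<open>Subspaces of functions, scaling and continuity criteria\<close>

definition func_subspace :: "('a \<Rightarrow> complex) set \<Rightarrow> bool" where
  "func_subspace V \<longleftrightarrow> (\<lambda>x. 0) \<in> V \<and> (\<forall>f\<in>V. \<forall>g\<in>V. \<forall>c d. (\<lambda>x. c * f x + d * g x) \<in> V)"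

lemma func_subspaceD:
  assumes "func_subspace V"
  shows "(\<lambda>x. 0) \<in> V" "f \<in> V \<Longrightarrow> g \<in> V \<Longrightarrow> (\<lambda>x. c * f x + d * g x) \<in> V"
    "f \<in> V \<Longrightarrow> g \<in> V \<Longrightarrow> (\<lambda>x. f x - g x) \<in> V" "f \<in> V \<Longrightarrow> (\<lambda>x. c * f x) \<in> V"
proof -
  show "(\<lambda>x. 0) \<in> V" using assms by (simp add: func_subspace_def)
  show lc: "(\<lambda>x. c * f x + d * g x) \<in> V" if "f \<in> V" "g \<in> V" for f g c d
    using assms that by (simp add: func_subspace_def)
  show "f \<in> V \<Longrightarrow> g \<in> V \<Longrightarrow> (\<lambda>x. f x - g x) \<in> V" using lc[of f g 1 "-1"] by simp
  show "f \<in> V \<Longrightarrow> (\<lambda>x. c * f x) \<in> V" using lc[of f f c 0] by simp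
qed

lemma seminorm_on_subset: "seminorm_on W p \<Longrightarrow> V \<subseteq> W \<Longrightarrow> seminorm_on V p"
  unfolding seminorm_on_def by blast

lemma seminorm_onD:
  assumes "seminorm_on V p" "f \<in> V"
  shows "p f \<ge> 0" "g \<in> V \<Longrightarrow> p (\<lambda>x. f x + g x) \<le> p f + p g" "p (\<lambda>x. c * f x) = cmod c * p f"
    "p (\<lambda>x. 0) = 0"
proof -
  show *: "p (\<lambda>x. c * f x) = cmod c * p f" for c using assms unfolding seminorm_on_def by blast
  show "p (\<lambda>x. 0) = 0" using *[of 0] by simp
qed (use assms in \<open>unfold seminorm_on_def, blast+\<close>)

lemma seminorm_on_diff_triangle:
  assumes "func_subspace V" "seminorm_on V p" "f \<in> V" "g \<in> V" "h \<in> V"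
  shows "p (\<lambda>x. f x - h x) \<le> p (\<lambda>x. f x - g x) + p (\<lambda>x. g x - h x)"
  using seminorm_onD(2)[OF assms(2), of "\<lambda>x. f x - g x" "\<lambda>x. g x - h x"] func_subspaceD(3)[OF assms(1)] assms
  by simp

text \<open>Homogeneity: \<open>f\<close> is scaled into the \<open>p\<close>-ball of radius
  \<open>e\<close>. The factor 2 keeps the scaled function strictly inside; if
  \<open>p f = 0\<close>, arbitrarily large scalings are allowed and force \<open>q f\<close> to
  vanish.\<close>

lemma seminorm_on_dominated:
  assumes V: "func_subspace V" and p: "seminorm_on V p" and q: "seminorm_on V q"
    and e: "e > 0" and c: "c > 0"
    and dom: "\<And>f. f \<in> V \<Longrightarrow> p f < e \<Longrightarrow> q f \<le> c" and f: "f \<in> V"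
  shows "q f \<le> 2 * c / e * p f"
proof -
  have scale: "q f \<le> c / t" if t: "t > 0" "t * p f < e" for t
  proof -
    have "q (\<lambda>x. of_real t * f x) \<le> c"
      using t by (intro dom func_subspaceD(4)[OF V f]) (simp add: seminorm_onD(3)[OF p f])
    then have "t * q f \<le> c" using t by (simp add: seminorm_onD(3)[OF q f])
    then show ?thesis using t by (simp add: field_simps)
  qed
  show ?thesis
  proof (cases "p f = 0")
    case True
    have "q f \<le> 0 + \<epsilon>" if "\<epsilon> > 0" for \<epsilon> using scale[of "c / \<epsilon>"] True e c that by simp
    then have "q f \<le> 0" by (rule field_le_epsilon)
    with True show ?thesis by simp
  next
    case False
    then have "p f > 0" using seminorm_onD(1)[OF p f] by simp
    then show ?thesis using scale[of "e / (2 * p f)"] e by (simp add: mult_ac)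
  qed
qed

text \<open>With one seminorm, a finite intersection of balls contains the smallest of them around
  each of its points, so balls form a base. This applies to the steps \<open>E_h\<close>, whose
  topology comes from one norm.\<close>

lemma openin_seminorm_topology_singletonD:
  assumes V: "func_subspace V" and p: "seminorm_on V p"
    and "openin (seminorm_topology V {p}) U" "f \<in> U"
  shows "\<exists>e>0. sball V p f e \<subseteq> U"
proof -
  have "generate_topology_on (insert V {sball V p f e | p' f e. p' \<in> {p} \<and> f \<in> V \<and> e > 0}) U"
    using assms(3) openin_topology_generated_by unfolding seminorm_topology_def by fastforce
  then show ?thesis using assms(4)
  proof (induction arbitrary: f)
    case (Int A B)
    then obtain d e where "d > 0" "sball V p f d \<subseteq> A" "e > 0" "sball V p f e \<subseteq> B" by blast
    then have "min d e > 0" "sball V p f (min d e) \<subseteq> A \<inter> B" by (auto simp: sball_def)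
    then show ?case by blast
  next
    case (UN K)
    then show ?case by (meson Sup_upper UnionE order_trans)
  next
    case (Basis s)
    show ?case
    proof (cases "s = V")
      case True
      then show ?thesis using sball_subset zero_less_one by blast
    next
      case False
      then obtain f0 e where s: "s = sball V p f0 e" "f0 \<in> V" using Basis by blast
      with Basis have f: "f \<in> V" "p (\<lambda>x. f x - f0 x) < e" by (auto simp: sball_def)
      have "sball V p f (e - p (\<lambda>x. f x - f0 x)) \<subseteq> s"
      proof
        fix g assume "g \<in> sball V p f (e - p (\<lambda>x. f x - f0 x))"
        then have g: "g \<in> V" "p (\<lambda>x. g x - f x) < e - p (\<lambda>x. f x - f0 x)" by (auto simp: sball_def)
        then show "g \<in> s"
          using seminorm_on_diff_triangle[OF V p g(1) f(1) s(2)] by (simp add: s sball_def)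
      qed
      then show ?thesis using f by (intro exI[of _ "e - p (\<lambda>x. f x - f0 x)"]) simp
    qed
  qed simp
qed

lemma openin_sball:
  assumes "p \<in> P" "f \<in> V" "e > 0"
  shows "openin (seminorm_topology V P) (sball V p f e)"
  unfolding seminorm_topology_def by (rule topology_generated_by_Basis) (use assms in blast)

lemma openin_seminorm_topologyI:
  assumes "\<And>p. p \<in> P \<Longrightarrow> seminorm_on V p"
    and "\<And>f. f \<in> U \<Longrightarrow> f \<in> V \<and> (\<exists>p\<in>P. \<exists>e>0. sball V p f e \<subseteq> U)"
  shows "openin (seminorm_topology V P) U"
proof (subst openin_subopen, rule ballI)
  fix f assume f: "f \<in> U"
  with assms(2) obtain p e where *: "f \<in> V" "p \<in> P" "e > 0" "sball V p f e \<subseteq> U" by blast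
  have "openin (seminorm_topology V P) (sball V p f e)"
    by (rule openin_sball[OF *(2,1,3)])
  moreover have "f \<in> sball V p f e"
    using * seminorm_onD(4)[OF assms(1)[OF *(2)] *(1)] by (simp add: sball_def)
  ultimately show "\<exists>T. openin (seminorm_topology V P) T \<and> f \<in> T \<and> T \<subseteq> U" using * by blast
qed

text \<open>Balls are compared through differences, so compatibility of \<open>T\<close> with
  subtraction is all the linearity required. A single dominating \<open>p\<close> for each
  \<open>q\<close> makes directedness of \<open>P\<close> irrelevant.\<close>

lemma continuous_map_seminorm_topologyI:
  assumes V: "func_subspace V" and W: "func_subspace W"
    and P: "\<And>p. p \<in> P \<Longrightarrow> seminorm_on V p" and Q: "\<And>q. q \<in> Q \<Longrightarrow> seminorm_on W q"
    and T: "\<And>f. f \<in> V \<Longrightarrow> T f \<in> W"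
    and diff: "\<And>f g. T (\<lambda>x. f x - g x) = (\<lambda>x. T f x - T g x)"
    and bound: "\<And>q. q \<in> Q \<Longrightarrow> \<exists>p\<in>P. \<exists>C\<ge>0. \<forall>f\<in>V. q (T f) \<le> C * p f"
  shows "continuous_map (seminorm_topology V P) (seminorm_topology W Q) T"
  unfolding continuous_map_seminorm_topology_iff topspace_seminorm_topology
proof (intro conjI ballI allI impI)
  show "T ` V \<subseteq> W" using T by blast
  fix q f0 and e :: real assume q: "q \<in> Q" and f0: "f0 \<in> W" and e: "e > 0"
  obtain p C where p: "p \<in> P" and C: "C \<ge> 0" "\<And>f. f \<in> V \<Longrightarrow> q (T f) \<le> C * p f"
    using bound[OF q] by blast
  show "openin (seminorm_topology V P) (T -` sball W q f0 e \<inter> V)"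
  proof (rule openin_seminorm_topologyI[OF P])
    fix f assume "f \<in> T -` sball W q f0 e \<inter> V"
    then have f: "f \<in> V" "q (\<lambda>x. T f x - f0 x) < e" by (auto simp: sball_def)
    \<comment> \<open>\<open>C\<close> may be 0, hence the denominator \<open>C + 1\<close>.\<close>
    define \<delta> where "\<delta> = (e - q (\<lambda>x. T f x - f0 x)) / (C + 1)"
    have \<delta>: "\<delta> > 0" using f C by (simp add: \<delta>_def)
    have "sball V p f \<delta> \<subseteq> T -` sball W q f0 e \<inter> V"
    proof
      fix g assume "g \<in> sball V p f \<delta>"
      then have g: "g \<in> V" "p (\<lambda>x. g x - f x) < \<delta>" by (auto simp: sball_def)
      have gf: "(\<lambda>x. g x - f x) \<in> V" using func_subspaceD(3)[OF V] g f by blast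
      have "q (\<lambda>x. T g x - T f x) \<le> C * p (\<lambda>x. g x - f x)"
        using C(2)[OF gf] by (simp add: diff)
      also have "\<dots> \<le> (C + 1) * p (\<lambda>x. g x - f x)"
        using seminorm_onD(1)[OF P[OF p] gf] by (simp add: distrib_right)
      also have "\<dots> < (C + 1) * \<delta>" using g C by (intro mult_strict_left_mono) auto
      also have "\<dots> = e - q (\<lambda>x. T f x - f0 x)" using C by (simp add: \<delta>_def)
      finally have "q (\<lambda>x. T g x - f0 x) < e"
        using seminorm_on_diff_triangle[OF W Q[OF q] T[OF g(1)] T[OF f(1)] f0] by linarith
      then show "g \<in> T -` sball W q f0 e \<inter> V" using g T by (simp add: sball_def)
    qed
    with p \<delta> f show "f \<in> V \<and> (\<exists>p\<in>P. \<exists>\<epsilon>>0. sball V p f \<epsilon> \<subseteq> T -` sball W q f0 e \<inter> V)" by blast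
  qed
qed

text \<open>Recovers a norm estimate from continuity of an inclusion: the preimage of the unit
  \<open>q\<close>-ball contains a \<open>p\<close>-ball, and scaling does the rest.\<close>

lemma continuous_map_seminorm_topologyD:
  assumes V: "func_subspace V" and p: "seminorm_on V p" and q: "seminorm_on W q" and "V \<subseteq> W"
    and cont: "continuous_map (seminorm_topology V {p}) (seminorm_topology W {q}) (\<lambda>f. f)"
  shows "\<exists>C\<ge>0. \<forall>f\<in>V. q f \<le> C * p f"
proof -
  have 0: "(\<lambda>x. 0) \<in> V" using func_subspaceD(1)[OF V] .
  have qV: "seminorm_on V q" using seminorm_on_subset[OF q \<open>V \<subseteq> W\<close>] .
  have "openin (seminorm_topology V {p}) ((\<lambda>f. f) -` sball W q (\<lambda>x. 0) 1 \<inter> V)"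
    using cont 0 \<open>V \<subseteq> W\<close> unfolding continuous_map_seminorm_topology_iff topspace_seminorm_topology
    by (meson insertI1 subsetD zero_less_one)
  moreover have "(\<lambda>x. 0) \<in> (\<lambda>f. f) -` sball W q (\<lambda>x. 0) 1 \<inter> V"
    using 0 \<open>V \<subseteq> W\<close> seminorm_onD(4)[OF qV 0] by (auto simp: sball_def)
  ultimately obtain e where e: "e > 0" "sball V p (\<lambda>x. 0) e \<subseteq> (\<lambda>f. f) -` sball W q (\<lambda>x. 0) 1 \<inter> V"
    using openin_seminorm_topology_singletonD[OF V p] by meson
  have "q f \<le> 1" if "f \<in> V" "p f < e" for f
  proof -
    have "f \<in> sball V p (\<lambda>x. 0) e" using that by (simp add: sball_def)
    with e show ?thesis by (force simp: sball_def)
  qed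
  from seminorm_on_dominated[OF V p qV e(1) zero_less_one this] e(1) show ?thesis
    by (intro exI[of _ "2 * 1 / e"]) auto
qed


section \<open>The spaces of ultradifferentiable functions\<close>

text \<open>Two continuous extensions agree on the interior, which is dense in a regular
  \<open>K\<close>. The choice in \<open>ext_pd\<close> is therefore harmless on
  \<open>K\<close>.\<close>

lemma ext_pd_eq:
  assumes K: "closure (interior K) = K" and g: "is_ext_pd K \<alpha> f g" and x: "x \<in> K"
  shows "ext_pd K \<alpha> f x = g x"
proof -
  have e: "is_ext_pd K \<alpha> f (ext_pd K \<alpha> f)" unfolding ext_pd_def using g by (rule someI[of "is_ext_pd K \<alpha> f"])
  have "ext_pd K \<alpha> f x - g x = 0"
  proof (rule continuous_constant_on_closure[of "interior K" "\<lambda>x. ext_pd K \<alpha> f x - g x"])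
    show "continuous_on (closure (interior K)) (\<lambda>x. ext_pd K \<alpha> f x - g x)"
      unfolding K using e g unfolding is_ext_pd_def by (intro continuous_on_diff) blast+
    show "ext_pd K \<alpha> f x - g x = 0" if "x \<in> interior K" for x
      using e g that unfolding is_ext_pd_def by simp
  qed (use x K in simp)
  then show ?thesis by simp
qed

lemma is_ext_pd_ext_pd:
  assumes "f \<in> C_inf_compact K"
  shows "is_ext_pd K \<alpha> f (ext_pd K \<alpha> f)"
proof -
  obtain g where "is_ext_pd K \<alpha> f g" using assms unfolding C_inf_compact_def by blast
  then show ?thesis unfolding ext_pd_def by (rule someI[of "is_ext_pd K \<alpha> f"])
qed

lemma ext_pd_interior:
  assumes "f \<in> C_inf_compact K" "x \<in> interior K"
  shows "ext_pd K \<alpha> f x = mpd \<alpha> f x"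
  using is_ext_pd_ext_pd[OF assms(1)] assms(2) unfolding is_ext_pd_def by blast

lemma is_ext_pd_linear_combination:
  assumes "f \<in> C_inf_compact K" "g \<in> C_inf_compact K"
  shows "is_ext_pd K \<alpha> (\<lambda>x. c * f x + d * g x) (\<lambda>x. c * ext_pd K \<alpha> f x + d * ext_pd K \<alpha> g x)"
  unfolding is_ext_pd_def
proof (intro conjI ballI)
  show "continuous_on K (\<lambda>x. c * ext_pd K \<alpha> f x + d * ext_pd K \<alpha> g x)"
    using is_ext_pd_ext_pd[OF assms(1)] is_ext_pd_ext_pd[OF assms(2)] unfolding is_ext_pd_def
    by (intro continuous_intros) blast+
  fix x assume x: "x \<in> interior K"
  have "smooth_on (interior K) f" "smooth_on (interior K) g"
    using assms unfolding C_inf_compact_def by blast+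
  from mpd_linear_combination[OF open_interior this x]
  show "c * ext_pd K \<alpha> f x + d * ext_pd K \<alpha> g x = mpd \<alpha> (\<lambda>x. c * f x + d * g x) x"
    unfolding ext_pd_interior[OF assms(1) x] ext_pd_interior[OF assms(2) x] ..
qed

lemma func_subspace_C_inf_compact: "func_subspace (C_inf_compact K)"
proof -
  have lc: "(\<lambda>x. c * f x + d * g x) \<in> C_inf_compact K"
    if fg: "f \<in> C_inf_compact K" "g \<in> C_inf_compact K" for f g c d
    unfolding C_inf_compact_def
  proof (intro CollectI conjI allI)
    show "(\<lambda>x. c * f x + d * g x) \<in> supp_in K"
      using fg unfolding C_inf_compact_def supp_in_def by simp
    show "continuous_on K (\<lambda>x. c * f x + d * g x)"
      using fg unfolding C_inf_compact_def by (intro continuous_intros) blast+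
    show "smooth_on (interior K) (\<lambda>x. c * f x + d * g x)"
      using fg unfolding C_inf_compact_def by (intro smooth_on_linear_combination) blast+
    show "\<exists>h. is_ext_pd K \<alpha> (\<lambda>x. c * f x + d * g x) h" for \<alpha>
      using is_ext_pd_linear_combination[OF fg] by blast
  qed
  have iter0: "iter_pd is (\<lambda>x. 0) = (\<lambda>x. 0)" for "is" :: "'a list"
    by (induction "is") (simp_all add: pd_def)
  then have "(\<lambda>x. 0) \<in> C_inf_compact K"
    unfolding C_inf_compact_def
    by (auto simp: supp_in_def smooth_on_def is_ext_pd_def mpd_def intro!: exI[of _ "\<lambda>x. 0"])
  with lc show ?thesis unfolding func_subspace_def by blast
qed

lemma ext_pd_linear_combination:
  assumes "closure (interior K) = K" "f \<in> C_inf_compact K" "g \<in> C_inf_compact K" "x \<in> K"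
  shows "ext_pd K \<alpha> (\<lambda>x. c * f x + d * g x) x = c * ext_pd K \<alpha> f x + d * ext_pd K \<alpha> g x"
  by (rule ext_pd_eq[OF assms(1) is_ext_pd_linear_combination[OF assms(2,3)] assms(4)])

text \<open>The closure of an open set is always regular. Radius \<open>e / 2\<close> leaves room
  for the closure inside the \<open>e\<close>-neighbourhood of \<open>K\<close>.\<close>

lemma ex_regular_nbhd:
  fixes K :: "(real^'n::finite) set"
  assumes "open \<Omega>" "compact K" "K \<subseteq> \<Omega>"
  obtains U where "open U" "K \<subseteq> U" "closure U \<in> regular_compacts \<Omega>"
proof -
  obtain e where e: "e > 0" "(\<Union>x\<in>K. ball x e) \<subseteq> \<Omega>"
    using compact_subset_open_imp_ball_epsilon_subset[OF assms(2,1,3)] by blast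
  define U where "U = (\<Union>x\<in>K. ball x (e / 2))"
  have U: "open U" "K \<subseteq> U" using e by (auto simp: U_def)
  have "closure U \<subseteq> \<Omega>"
  proof
    fix y assume "y \<in> closure U"
    then obtain u where u: "u \<in> U" "dist u y < e / 2"
      using closure_approachable e by (meson half_gt_zero)
    then obtain x where "x \<in> K" "dist x u < e / 2" by (auto simp: U_def)
    then have "x \<in> K" "y \<in> ball x e" using u dist_triangle[of x y u] by auto
    then show "y \<in> \<Omega>" using e by blast
  qed
  moreover have "compact (closure U)"
  proof -
    obtain b where b: "\<And>x. x \<in> K \<Longrightarrow> norm x \<le> b"
      using compact_imp_bounded[OF assms(2)] unfolding bounded_iff by blast
    have "norm y \<le> b + e / 2" if "y \<in> U" for y
    proof -
      obtain x where "x \<in> K" "dist x y < e / 2" using \<open>y \<in> U\<close> by (auto simp: U_def)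
      then show ?thesis
        using b[of x] norm_triangle_sub[of y x] by (simp add: dist_norm norm_minus_commute)
    qed
    then have "bounded U" unfolding bounded_iff by blast
    then show ?thesis by (simp add: compact_closure)
  qed
  moreover have "closure (interior (closure U)) = closure U"
  proof (rule antisym)
    show "closure (interior (closure U)) \<subseteq> closure U"
      using closure_mono[OF interior_subset[of "closure U"]] by simp
    show "closure U \<subseteq> closure (interior (closure U))"
      using U(1) by (intro closure_mono interior_maximal closure_subset)
  qed
  ultimately show ?thesis using U by (intro that) (auto simp: regular_compacts_def)
qed

text \<open>For a function smooth around \<open>K\<close>, its own derivative serves as the
  continuous extension, including at boundary points where \<open>restr K\<close> need not be
  differentiable.\<close>

lemma is_ext_pd_restr:
  assumes "open U" "K \<subseteq> U" "smooth_on U \<phi>"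
  shows "is_ext_pd K \<alpha> (restr K \<phi>) (mpd \<alpha> \<phi>)"
  unfolding is_ext_pd_def
proof (intro conjI ballI)
  show "continuous_on K (mpd \<alpha> \<phi>)"
    using continuous_on_mpd[OF assms(3)] assms(2) continuous_on_subset by blast
  show "mpd \<alpha> \<phi> x = mpd \<alpha> (restr K \<phi>) x" if "x \<in> interior K" for x
    using that by (rule mpd_cong[OF open_interior]) (use interior_subset in \<open>auto simp: restr_def\<close>)
qed

lemma restr_in_C_inf_compact:
  assumes "open U" "K \<subseteq> U" "smooth_on U \<phi>"
  shows "restr K \<phi> \<in> C_inf_compact K"
  unfolding C_inf_compact_def
proof (intro CollectI conjI allI)
  show "restr K \<phi> \<in> supp_in K" by (simp add: restr_def supp_in_def)
  have "continuous_on K \<phi>"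
    using smooth_on_imp_continuous_on[OF assms(3), of "[]"] assms(2) continuous_on_subset by auto
  then show "continuous_on K (restr K \<phi>)"
    by (subst continuous_on_cong[OF refl, of K _ \<phi>]) (simp_all add: restr_def)
  have int: "interior K \<subseteq> K" by (rule interior_subset)
  have "smooth_on (interior K) \<phi>" using smooth_on_subset[OF assms(3)] int assms(2) by blast
  then show "smooth_on (interior K) (restr K \<phi>)"
    by (rule smooth_on_cong[OF open_interior]) (use int in \<open>auto simp: restr_def\<close>)
  show "\<exists>g. is_ext_pd K \<alpha> (restr K \<phi>) g" for \<alpha>
    using is_ext_pd_restr[OF assms] by blast
qed

lemma norm_h_restr:
  assumes "closure (interior K) = K" "open U" "K \<subseteq> U" "smooth_on U \<phi>"
  shows "norm_h M h K (restr K \<phi>) = wsup K (\<lambda>p. h ^ p * M p) (\<lambda>\<alpha>. mpd \<alpha> \<phi>)"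
  unfolding norm_h_def using ext_pd_eq[OF assms(1) is_ext_pd_restr[OF assms(2-4)]]
  by (rule wsup_cong)

lemma restr_linear_combination:
  "restr K (\<lambda>x. c * f x + d * g x) = (\<lambda>x. c * restr K f x + d * restr K g x)"
  by (auto simp: restr_def)

lemma restr_diff: "restr K (\<lambda>x. f x - g x) = (\<lambda>x. restr K f x - restr K g x)"
  by (auto simp: restr_def)

lemma all_mpd_iff_all_iter_pd:
  fixes f :: "real^'n::finite \<Rightarrow> complex"
  assumes "open U" "smooth_on U f" "K \<subseteq> U"
  shows "(\<forall>\<alpha>. \<forall>x\<in>K. P (mpd \<alpha> f x) (mi_abs \<alpha>)) \<longleftrightarrow> (\<forall>is. \<forall>x\<in>K. P (iter_pd is f x) (length is))"
  unfolding all_multi_index_iff mi_abs_count_list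
proof (intro iff_allI ball_cong refl)
  fix "is" x assume "x \<in> K"
  then have "x \<in> U" using assms(3) by blast
  from mpd_eq_iter_pd[OF assms(1,2) this]
  show "P (mpd (count_list is) f x) (length is) \<longleftrightarrow> P (iter_pd is f x) (length is)" by simp
qed

section \<open>The steps, their union and the projective limit as vector spaces\<close>

context
  fixes M :: "nat \<Rightarrow> real"
  assumes M_pos: "\<And>p. M p > 0"
begin

lemma weight_pos: "h > 0 \<Longrightarrow> h ^ p * M p > 0"
  using M_pos by simp

lemma norm_h_mono_finite:
  assumes "0 < h" "h \<le> h'" "norm_h M h K f < \<infinity>"
  shows "norm_h M h' K f < \<infinity>"
proof -
  obtain c where c: "c \<ge> 0" "\<And>\<alpha> x. x \<in> K \<Longrightarrow> cmod (ext_pd K \<alpha> f x) \<le> c * (h ^ mi_abs \<alpha> * M (mi_abs \<alpha>))"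
    using assms(3) weight_pos[OF assms(1)] unfolding norm_h_def
    by (subst (asm) wsup_less_top_iff) auto
  have le: "c * (h ^ p * M p) \<le> c * (h' ^ p * M p)" for p
    using assms c(1) M_pos[of p] by (intro mult_left_mono mult_right_mono power_mono) auto
  show ?thesis
    unfolding norm_h_def
  proof (subst wsup_less_top_iff)
    show "h' ^ p * M p > 0" for p using weight_pos assms by simp
    show "\<exists>c\<ge>0. \<forall>\<alpha>. \<forall>x\<in>K. cmod (ext_pd K \<alpha> f x) \<le> c * (h' ^ mi_abs \<alpha> * M (mi_abs \<alpha>))"
      using c(1) order_trans[OF c(2) le] by blast
  qed
qed

lemma E_h_mono:
  assumes "0 < h" "h \<le> h'"
  shows "E_h M h K \<subseteq> E_h M h' K"
  using norm_h_mono_finite[OF assms] unfolding E_h_def by blast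

lemma func_subspace_E_h:
  assumes K: "closure (interior K) = K" and h: "h > 0"
  shows "func_subspace (E_h M h K)"
  unfolding func_subspace_def
proof (intro conjI ballI allI)
  have fin_iff: "norm_h M h K f < \<infinity> \<longleftrightarrow>
      (\<exists>c\<ge>0. \<forall>\<alpha>. \<forall>x\<in>K. cmod (ext_pd K \<alpha> f x) \<le> c * (h ^ mi_abs \<alpha> * M (mi_abs \<alpha>)))" for f
    unfolding norm_h_def by (rule wsup_less_top_iff) (rule weight_pos[OF h])
  have lc: "(\<lambda>x. c * f x + d * g x) \<in> E_h M h K"
    if f: "f \<in> C_inf_compact K" "norm_h M h K f < \<infinity>" and g: "g \<in> C_inf_compact K" "norm_h M h K g < \<infinity>" for f g c d
  proof -
    let ?w = "\<lambda>\<alpha>. h ^ mi_abs \<alpha> * M (mi_abs \<alpha>)"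
    obtain a where a: "a \<ge> 0" "\<And>\<alpha> x. x \<in> K \<Longrightarrow> cmod (ext_pd K \<alpha> f x) \<le> a * ?w \<alpha>"
      using f(2) fin_iff by blast
    obtain b where b: "b \<ge> 0" "\<And>\<alpha> x. x \<in> K \<Longrightarrow> cmod (ext_pd K \<alpha> g x) \<le> b * ?w \<alpha>"
      using g(2) fin_iff by blast
    have "cmod (ext_pd K \<alpha> (\<lambda>x. c * f x + d * g x) x) \<le> (cmod c * a + cmod d * b) * ?w \<alpha>"
      if x: "x \<in> K" for \<alpha> x
    proof -
      have "cmod (c * ext_pd K \<alpha> f x + d * ext_pd K \<alpha> g x)
        \<le> cmod c * cmod (ext_pd K \<alpha> f x) + cmod d * cmod (ext_pd K \<alpha> g x)"
        using norm_triangle_ineq[of "c * ext_pd K \<alpha> f x" "d * ext_pd K \<alpha> g x"] by (simp add: norm_mult)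
      also have "\<dots> \<le> cmod c * (a * ?w \<alpha>) + cmod d * (b * ?w \<alpha>)"
        using a(2)[OF x] b(2)[OF x] by (intro add_mono mult_left_mono) auto
      finally show ?thesis
        unfolding ext_pd_linear_combination[OF K f(1) g(1) x] by (simp add: algebra_simps)
    qed
    then have "norm_h M h K (\<lambda>x. c * f x + d * g x) < \<infinity>"
      unfolding fin_iff using a(1) b(1) by (intro exI[of _ "cmod c * a + cmod d * b"]) auto
    then show ?thesis
      using func_subspaceD(2)[OF func_subspace_C_inf_compact f(1) g(1)] unfolding E_h_def by blast
  qed
  show "(\<lambda>x. c * f x + d * g x) \<in> E_h M h K" if "f \<in> E_h M h K" "g \<in> E_h M h K" for f g c d
    using that unfolding E_h_def[of M h K] by (intro lc[unfolded E_h_def]) auto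
  have 0: "(\<lambda>x. 0) \<in> C_inf_compact K" by (rule func_subspaceD(1)[OF func_subspace_C_inf_compact])
  have "ext_pd K \<alpha> (\<lambda>x. 0) x = 0" if "x \<in> K" for \<alpha> x
    using ext_pd_linear_combination[OF K 0 0 that, of \<alpha> 0 0] by simp
  then have "norm_h M h K (\<lambda>x. 0) < \<infinity>" unfolding fin_iff by (intro exI[of _ 0]) simp
  with 0 show "(\<lambda>x. 0) \<in> E_h M h K" unfolding E_h_def by blast
qed

lemma seminorm_on_norm_h:
  assumes K: "closure (interior K) = K" and h: "h > 0"
  shows "seminorm_on (E_h M h K) (\<lambda>f. enn2real (norm_h M h K f))"
  unfolding norm_h_def
proof (rule seminorm_on_wsup)
  show "ext_pd K \<alpha> (\<lambda>x. c * f x + d * g x) x = c * ext_pd K \<alpha> f x + d * ext_pd K \<alpha> g x"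
    if "f \<in> E_h M h K" "g \<in> E_h M h K" "x \<in> K" for f g c d \<alpha> x
    using that unfolding E_h_def by (intro ext_pd_linear_combination[OF K]) auto
  show "h ^ p * M p > 0" for p using weight_pos[OF h] .
qed (simp add: E_h_def norm_h_def)

lemma func_subspace_E_compact:
  assumes K: "closure (interior K) = K"
  shows "func_subspace (E_compact M K)"
  unfolding func_subspace_def
proof (intro conjI ballI allI)
  show "(\<lambda>x. 0) \<in> E_compact M K"
    using func_subspaceD(1)[OF func_subspace_E_h[OF K zero_less_one]] unfolding E_compact_def by force
  fix f g c d assume "f \<in> E_compact M K" "g \<in> E_compact M K"
  then obtain h h' where h: "h > 0" "f \<in> E_h M h K" "h' > 0" "g \<in> E_h M h' K"
    unfolding E_compact_def by auto
  then have "f \<in> E_h M (max h h') K" "g \<in> E_h M (max h h') K"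
    using E_h_mono[of h "max h h'" K] E_h_mono[of h' "max h h'" K] by auto
  then have "(\<lambda>x. c * f x + d * g x) \<in> E_h M (max h h') K"
    using h by (intro func_subspaceD(2)[OF func_subspace_E_h[OF K]]) auto
  then show "(\<lambda>x. c * f x + d * g x) \<in> E_compact M K"
    using h unfolding E_compact_def by (intro UN_I[of "max h h'"]) auto
qed

lemma E_h_subset_E_compact: "h > 0 \<Longrightarrow> E_h M h K \<subseteq> E_compact M K"
  unfolding E_compact_def by (rule UN_upper) simp

text \<open>Replaces restrictions and extended derivatives by the derivatives of the function
  itself, on arbitrary compact sets. An irregular \<open>K\<close> is enclosed in an open
  \<open>U\<close> with regular closure, and on \<open>U\<close> the extended derivatives are the
  genuine ones.\<close>

lemma mem_E_open_iff:
  fixes \<Omega> :: "(real^'n::finite) set"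
  assumes \<Omega>: "open \<Omega>"
  shows "\<phi> \<in> E_open M \<Omega> \<longleftrightarrow> \<phi> \<in> C_inf \<Omega> \<and>
    (\<forall>K. compact K \<and> K \<subseteq> \<Omega> \<longrightarrow> (\<exists>h>0. wsup K (\<lambda>p. h ^ p * M p) (\<lambda>\<alpha>. mpd \<alpha> \<phi>) < \<infinity>))"
proof (intro iffI conjI allI impI)
  assume \<phi>: "\<phi> \<in> E_open M \<Omega>"
  have loc: "\<exists>h>0. restr (closure U) \<phi> \<in> E_h M h (closure U)" if "closure U \<in> regular_compacts \<Omega>" for U
    using \<phi> that unfolding E_open_def E_compact_def by auto
  have smooth_loc: "smooth_on U (restr (closure U) \<phi>)"
    if U: "open U" "closure U \<in> regular_compacts \<Omega>" for U
  proof -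
    have "smooth_on (interior (closure U)) (restr (closure U) \<phi>)"
      using loc[OF U(2)] unfolding E_h_def C_inf_compact_def by blast
    then show ?thesis by (rule smooth_on_subset) (use U(1) closure_subset interior_maximal in blast)
  qed
  have restr_eq: "restr (closure U) \<phi> y = \<phi> y" if "y \<in> U" for U y
    using that closure_subset by (auto simp: restr_def)
  \<comment> \<open>Smoothness is local, so a regular neighbourhood of each single point
    suffices.\<close>
  have "smooth_on \<Omega> \<phi>"
    unfolding smooth_on_iff_differentiable_at[OF \<Omega>]
  proof (intro allI ballI)
    fix "is" x assume "x \<in> \<Omega>"
    then obtain U where U: "open U" "x \<in> U" "closure U \<in> regular_compacts \<Omega>"
      using ex_regular_nbhd[OF \<Omega>, of "{x}"] by auto
    have "smooth_on U \<phi>"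
      by (rule smooth_on_cong[OF U(1) smooth_loc[OF U(1,3)]]) (rule restr_eq)
    then show "iter_pd is \<phi> differentiable (at x)"
      using U smooth_on_iff_differentiable_at by blast
  qed
  then show "\<phi> \<in> C_inf \<Omega>" using \<phi> unfolding C_inf_def E_open_def by blast
  fix K :: "(real^'n) set" assume K: "compact K \<and> K \<subseteq> \<Omega>"
  then obtain U where U: "open U" "K \<subseteq> U" "closure U \<in> regular_compacts \<Omega>"
    using ex_regular_nbhd[OF \<Omega>] by blast
  obtain h where h: "h > 0" "restr (closure U) \<phi> \<in> C_inf_compact (closure U)"
    "norm_h M h (closure U) (restr (closure U) \<phi>) < \<infinity>"
    using loc[OF U(3)] unfolding E_h_def by blast
  obtain c where c: "c \<ge> 0" "\<And>\<alpha> x. x \<in> closure U \<Longrightarrow>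
      cmod (ext_pd (closure U) \<alpha> (restr (closure U) \<phi>) x) \<le> c * (h ^ mi_abs \<alpha> * M (mi_abs \<alpha>))"
    using h(3) weight_pos[OF h(1)] unfolding norm_h_def by (subst (asm) wsup_less_top_iff) auto
  have "cmod (mpd \<alpha> \<phi> x) \<le> c * (h ^ mi_abs \<alpha> * M (mi_abs \<alpha>))" if "x \<in> K" for \<alpha> x
  proof -
    have x: "x \<in> U" using that U by blast
    then have "x \<in> interior (closure U)" using U(1) closure_subset interior_maximal by blast
    from ext_pd_interior[OF h(2) this]
    have "ext_pd (closure U) \<alpha> (restr (closure U) \<phi>) x = mpd \<alpha> (restr (closure U) \<phi>) x" .
    also have "\<dots> = mpd \<alpha> \<phi> x" by (rule mpd_cong[OF U(1) x]) (rule restr_eq)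
    finally show ?thesis using c(2)[of x \<alpha>] x closure_subset by auto
  qed
  then show "\<exists>h>0. wsup K (\<lambda>p. h ^ p * M p) (\<lambda>\<alpha>. mpd \<alpha> \<phi>) < \<infinity>"
    using h(1) c(1) weight_pos[OF h(1)] by (intro exI[of _ h] conjI, simp, subst wsup_less_top_iff) auto
next
  assume *: "\<phi> \<in> C_inf \<Omega> \<and>
    (\<forall>K. compact K \<and> K \<subseteq> \<Omega> \<longrightarrow> (\<exists>h>0. wsup K (\<lambda>p. h ^ p * M p) (\<lambda>\<alpha>. mpd \<alpha> \<phi>) < \<infinity>))"
  then have smooth: "smooth_on \<Omega> \<phi>" and supp: "\<phi> \<in> supp_in \<Omega>" unfolding C_inf_def by blast+
  have "restr K \<phi> \<in> E_compact M K" if "K \<in> regular_compacts \<Omega>" for K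
  proof -
    have K: "compact K" "closure (interior K) = K" "K \<subseteq> \<Omega>" using that unfolding regular_compacts_def by auto
    then obtain h where "h > 0" "wsup K (\<lambda>p. h ^ p * M p) (\<lambda>\<alpha>. mpd \<alpha> \<phi>) < \<infinity>" using * by blast
    then have "h > 0" "restr K \<phi> \<in> E_h M h K"
      using restr_in_C_inf_compact[OF \<Omega> K(3) smooth] norm_h_restr[OF K(2) \<Omega> K(3) smooth]
      unfolding E_h_def by auto
    then show ?thesis using E_h_subset_E_compact by blast
  qed
  with supp show "\<phi> \<in> E_open M \<Omega>" unfolding E_open_def by blast
qed

lemma func_subspace_E_open:
  assumes "open \<Omega>"
  shows "func_subspace (E_open M \<Omega>)"
  unfolding func_subspace_def
proof (intro conjI ballI allI)
  have K: "func_subspace (E_compact M K)" if "K \<in> regular_compacts \<Omega>" for K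
    using that by (intro func_subspace_E_compact) (simp add: regular_compacts_def)
  have "restr K (\<lambda>x. 0) = (\<lambda>x. 0)" for K :: "(real^'a) set" by (auto simp: restr_def)
  then show "(\<lambda>x. 0) \<in> E_open M \<Omega>"
    unfolding E_open_def using func_subspaceD(1)[OF K] by (simp add: supp_in_def)
  show "(\<lambda>x. c * f x + d * g x) \<in> E_open M \<Omega>" if "f \<in> E_open M \<Omega>" "g \<in> E_open M \<Omega>" for f g c d
    unfolding E_open_def
  proof (intro CollectI conjI ballI)
    show "(\<lambda>x. c * f x + d * g x) \<in> supp_in \<Omega>" using that by (simp add: E_open_def supp_in_def)
    show "restr K (\<lambda>x. c * f x + d * g x) \<in> E_compact M K" if "K \<in> regular_compacts \<Omega>" for K
      unfolding restr_linear_combination using that \<open>f \<in> E_open M \<Omega>\<close> \<open>g \<in> E_open M \<Omega>\<close>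
      by (intro func_subspaceD(2)[OF K]) (auto simp: E_open_def)
  qed
qed

end


section \<open>Sequences in \<open>seqs_R\<close> and the compactness argument\<close>

text \<open>For strictly increasing \<open>P\<close> with \<open>P 0 = 0\<close> this is the step
  sequence with value \<open>k + 1\<close> from \<open>P k\<close> up to, but not including,
  \<open>P (k + 1)\<close>.\<close>

definition threshold_seq :: "(nat \<Rightarrow> nat) \<Rightarrow> nat \<Rightarrow> real" where
  "threshold_seq P j = real (card {k. P k \<le> j})"

lemma finite_threshold:
  assumes "strict_mono P"
  shows "finite {k::nat. P k \<le> (j::nat)}"
  by (rule finite_subset[of _ "{..j}"]) (use strict_mono_imp_increasing[OF assms] order_trans in auto)

lemma threshold_seq_at:
  assumes "strict_mono P"
  shows "threshold_seq P (P n) = real (Suc n)"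
proof -
  have "{k. P k \<le> P n} = {..n}" using strict_mono_less_eq[OF assms] by auto
  then show ?thesis by (simp add: threshold_seq_def)
qed

lemma incseq_threshold_seq:
  assumes "strict_mono P"
  shows "incseq (threshold_seq P)"
  unfolding incseq_def threshold_seq_def
  by (auto intro!: card_mono finite_threshold[OF assms])

lemma threshold_seq_in_seqs_R:
  assumes P: "strict_mono P" "P 0 = 0"
  shows "threshold_seq P \<in> seqs_R"
proof -
  have inc: "incseq (threshold_seq P)" using incseq_threshold_seq[OF P(1)] .
  have 0: "threshold_seq P 0 = 1" using threshold_seq_at[OF P(1), of 0] P(2) by simp
  have "threshold_seq P j > 0" for j using incseqD[OF inc, of 0 j] 0 by simp
  moreover have "filterlim (threshold_seq P) at_top sequentially"
    unfolding filterlim_at_top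
  proof
    fix Z :: real
    obtain n :: nat where "Z \<le> real n" using real_arch_simple by blast
    then have "Z \<le> threshold_seq P j" if "j \<ge> P n" for j
      using incseqD[OF inc that] threshold_seq_at[OF P(1), of n] by simp
    then show "\<forall>\<^sub>F j in sequentially. Z \<le> threshold_seq P j"
      unfolding eventually_sequentially by blast
  qed
  ultimately show ?thesis using 0 inc unfolding seqs_R_def by blast
qed

text \<open>The factor at index 0 is 1, so only \<open>p\<close> factors count and the exponent is
  \<open>p\<close>, not \<open>p + 1\<close>.\<close>

lemma prod_seqs_R_le:
  assumes "r \<in> seqs_R"
  shows "(\<Prod>j=0..p. r j) \<le> r p ^ p"
proof -
  have r: "r 0 = 1" "\<And>j. r j > 0" "incseq r" using assms unfolding seqs_R_def by auto
  have "(\<Prod>j=0..p. r j) = r 0 * (\<Prod>j=Suc 0..p. r j)" by (rule prod.atLeast_Suc_atMost) simp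
  also have "\<dots> \<le> r 0 * (\<Prod>j=Suc 0..p. r p)"
    using r(1) r(2)[THEN less_imp_le] incseqD[OF r(3)] by (simp only: mult_1 r(1)) (intro prod_mono, auto)
  finally show ?thesis using r(1) by simp
qed

text \<open>Passing from \<open>n\<close> to \<open>n + 1\<close> multiplies the quotient of the two
  sides by \<open>h / r (n + 1)\<close>, which is at most 1 from some index on. The finitely many
  earlier quotients are bounded by their sum.\<close>

lemma power_le_prod_seqs_R:
  assumes r: "r \<in> seqs_R" and h: "h > 0"
  shows "\<exists>C>0. \<forall>p. h ^ p \<le> C * (\<Prod>j=0..p. r j)"
proof -
  have r': "\<And>j. r j > 0" "filterlim r at_top sequentially" using r unfolding seqs_R_def by auto
  obtain N where N: "\<And>j. j \<ge> N \<Longrightarrow> h \<le> r j"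
    using r'(2) unfolding filterlim_at_top eventually_sequentially by blast
  define a where "a p = h ^ p / (\<Prod>j=0..p. r j)" for p
  have prod_pos: "(\<Prod>j=0..p. r j) > 0" for p using r'(1) by (intro prod_pos) simp
  have a: "a p > 0" for p using prod_pos h by (simp add: a_def)
  define C where "C = (\<Sum>i\<le>N. a i)"
  have le: "a i \<le> C" if "i \<le> N" for i
    unfolding C_def by (rule member_le_sum) (use that a less_imp_le in auto)
  have a_le: "a p \<le> C" for p
  proof (cases "p \<le> N")
    case False
    then have "N \<le> p" by simp
    then show ?thesis
    proof (induction rule: dec_induct)
      case (step n)
      have "a (Suc n) = a n * (h / r (Suc n))" by (simp add: a_def)
      also have "\<dots> \<le> a n * 1"
        using N[of "Suc n"] step.hyps r'(1) a[of n] by (intro mult_left_mono) auto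
      finally show ?case using step.IH by simp
    qed (simp add: le)
  qed (rule le)
  have "h ^ p \<le> C * (\<Prod>j=0..p. r j)" for p
    using a_le[of p] unfolding a_def pos_divide_le_eq[OF prod_pos] .
  moreover have "C > 0" using a[of 0] le[of 0] by simp
  ultimately show ?thesis by blast
qed

lemma geometric_bound_if_seqs_R_bounds:
  fixes a :: "nat \<Rightarrow> real"
  assumes a: "\<And>p. a p \<ge> 0" and bound: "\<And>r. r \<in> seqs_R \<Longrightarrow> \<exists>C. \<forall>p. a p \<le> C * (\<Prod>j=0..p. r j)"
  shows "\<exists>h>0. \<exists>C. \<forall>p. a p \<le> C * h ^ p"
proof (rule ccontr)
  assume "\<not> (\<exists>h>0. \<exists>C. \<forall>p. a p \<le> C * h ^ p)"
  then have large: "\<exists>p. a p > C * h ^ p" if "h > 0" for h C using that not_le by blast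
  \<comment> \<open>The threshold sequence takes the value \<open>k + 2\<close> at
    \<open>P (Suc k)\<close>, so its product up to there is at most \<open>(k + 2) ^ p\<close>. The
    additional factor \<open>k + 2\<close> will outgrow every constant.\<close>
  have "\<exists>p>n. a p > real (k + 2) * real (k + 2) ^ p" for n k
  proof -
    \<comment> \<open>The sum is added only to push \<open>p\<close> beyond \<open>n\<close>: no
      \<open>a p\<close> with \<open>p\<close> at most \<open>n\<close> can exceed it.\<close>
    obtain p where p: "a p > (real (k + 2) + (\<Sum>i\<le>n. a i)) * real (k + 2) ^ p"
      using large[of "real (k + 2)"] by auto
    have S: "(\<Sum>i\<le>n. a i) \<ge> 0" using a by (rule sum_nonneg)
    have "p > n"
    proof (rule ccontr)
      assume "\<not> n < p"
      then have "a p \<le> (\<Sum>i\<le>n. a i)" using a by (intro member_le_sum) auto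
      also have "\<dots> \<le> (real (k + 2) + (\<Sum>i\<le>n. a i)) * 1" by simp
      also have "\<dots> \<le> (real (k + 2) + (\<Sum>i\<le>n. a i)) * real (k + 2) ^ p"
        using S by (intro mult_left_mono one_le_power) auto
      finally show False using p by simp
    qed
    moreover have "real (k + 2) * real (k + 2) ^ p < a p"
    proof (rule le_less_trans[OF _ p])
      show "real (k + 2) * real (k + 2) ^ p \<le> (real (k + 2) + (\<Sum>i\<le>n. a i)) * real (k + 2) ^ p"
        using S by (intro mult_right_mono) auto
    qed
    ultimately show ?thesis by blast
  qed
  then obtain F where F: "\<And>n k. F n k > n"
    "\<And>n k. a (F n k) > real (k + 2) * real (k + 2) ^ F n k" by metis
  define P where "P = rec_nat 0 (\<lambda>k n. F n k)"
  have P: "P 0 = 0" "\<And>k. P (Suc k) = F (P k) k" by (simp_all add: P_def)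
  have "strict_mono P" unfolding strict_mono_Suc_iff P(2) using F(1) by blast
  then have r: "threshold_seq P \<in> seqs_R" using P(1) by (rule threshold_seq_in_seqs_R)
  then obtain C where C: "\<And>p. a p \<le> C * (\<Prod>j=0..p. threshold_seq P j)" using bound by blast
  have "real (k + 2) < \<bar>C\<bar>" for k
  proof -
    let ?p = "P (Suc k)"
    have "real (k + 2) * real (k + 2) ^ ?p < a ?p" unfolding P(2) by (rule F)
    also have "\<dots> \<le> \<bar>C\<bar> * (\<Prod>j=0..?p. threshold_seq P j)"
      using C[of ?p] by (rule order_trans) (intro mult_right_mono prod_nonneg, auto simp: threshold_seq_def)
    also have "\<dots> \<le> \<bar>C\<bar> * real (k + 2) ^ ?p"
      using prod_seqs_R_le[OF r, of ?p] threshold_seq_at[OF \<open>strict_mono P\<close>, of "Suc k"]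
      by (intro mult_left_mono) auto
    finally show ?thesis by (rule mult_right_less_imp_less) simp
  qed
  moreover obtain k :: nat where "\<bar>C\<bar> \<le> real k" using real_arch_simple by blast
  ultimately show False by (metis add_leE less_le_not_le of_nat_le_iff order_trans le_add1)
qed

text \<open>The bridge from list-indexed estimates, as the compactness results give them, to the
  norm of the step over \<open>K\<close>.\<close>

lemma iter_pd_bound_restr:
  fixes f :: "real^'n::finite \<Rightarrow> complex"
  assumes M: "\<And>p. M p > 0" and K: "closure (interior K) = K" and U: "open U" "K \<subseteq> U"
    and f: "smooth_on U f" and h: "h > 0" "C \<ge> 0"
    and bound: "\<And>is x. x \<in> K \<Longrightarrow> cmod (iter_pd is f x) \<le> C * h ^ length is * M (length is)"
  shows "restr K f \<in> E_h M h K" "enn2real (norm_h M h K (restr K f)) \<le> C"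
proof -
  have w: "h ^ p * M p > 0" for p using M h by simp
  have "\<forall>\<alpha>. \<forall>x\<in>K. cmod (mpd \<alpha> f x) \<le> C * (h ^ mi_abs \<alpha> * M (mi_abs \<alpha>))"
    by (subst all_mpd_iff_all_iter_pd[OF U(1) f U(2), of "\<lambda>z p. cmod z \<le> C * (h ^ p * M p)"])
      (use bound in \<open>simp add: mult.assoc\<close>)
  then have le: "norm_h M h K (restr K f) \<le> ennreal C"
    unfolding norm_h_restr[OF K U f] by (subst wsup_le_iff[OF w h(2)])
  then show "enn2real (norm_h M h K (restr K f)) \<le> C" using h(2) by (rule enn2real_leI[rotated])
  show "restr K f \<in> E_h M h K"
    unfolding E_h_def using restr_in_C_inf_compact[OF U f] le
    by (auto simp: le_less_trans[OF _ ennreal_less_top])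
qed

text \<open>\<open>bounded_class M U b\<close> plays the role of a basic neighbourhood of zero: the projective
  description amounts to choosing \<open>b\<close> of the form \<open>\<Prod>j\<le>p. r j\<close>.\<close>

definition bounded_class ::
  "(nat \<Rightarrow> real) \<Rightarrow> (real^'n::finite) set \<Rightarrow> (nat \<Rightarrow> real) \<Rightarrow> (real^'n \<Rightarrow> complex) set" where
  "bounded_class M U b = {f. smooth_on U f \<and>
     (\<forall>is. \<forall>x\<in>U. cmod (iter_pd is f x) \<le> b (length is) * M (length is))}"

text \<open>\<open>bounded\<close> is continuity of \<open>q\<close> on every step, written as a
  norm estimate.\<close>

locale step_continuous_seminorm =
  fixes M :: "nat \<Rightarrow> real" and K U :: "(real^'n::finite) set" and q :: "(real^'n \<Rightarrow> complex) \<Rightarrow> real"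
  assumes M: "\<And>p. M p > 0" and K: "compact K" "closure (interior K) = K"
    and U: "open U" "K \<subseteq> U" and q: "seminorm_on (E_compact M K) q"
    and bounded: "\<And>h. h > 0 \<Longrightarrow> \<exists>C\<ge>0. \<forall>f\<in>E_h M h K. q f \<le> C * enn2real (norm_h M h K f)"
begin

text \<open>The compactness step: enlarging the bounds only from a sufficiently high order on keeps the
  class inside the open \<open>q\<close>-ball, since otherwise the counterexamples would accumulate at an
  element of \<open>bounded_class M U b\<close>.\<close>

lemma enlarge_bounds:
  assumes b: "\<And>p. b p \<le> b' p" and b': "\<And>p. b' p \<le> C * h ^ p" and h: "h > 0" "C \<ge> 0"
    and ball: "\<And>f. f \<in> bounded_class M U b \<Longrightarrow> q (restr K f) < c"
  shows "\<exists>n>m. \<forall>f\<in>bounded_class M U (\<lambda>p. if p < n then b p else b' p). q (restr K f) < c"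
proof (rule ccontr)
  let ?B = "\<lambda>n. bounded_class M U (\<lambda>p. if p < n then b p else b' p)"
  assume neg: "\<not> ?thesis"
  have "\<exists>f. f \<in> ?B (Suc m + n) \<and> q (restr K f) \<ge> c" for n
  proof -
    have "m < Suc m + n" by simp
    with neg have "\<not> (\<forall>f\<in>?B (Suc m + n). q (restr K f) < c)" by blast
    then show ?thesis unfolding not_less[symmetric] by blast
  qed
  then have "\<exists>f. \<forall>n. f n \<in> ?B (Suc m + n) \<and> q (restr K (f n)) \<ge> c" by (intro choice allI)
  then obtain f where f: "\<And>n. f n \<in> ?B (Suc m + n)" "\<And>n. q (restr K (f n)) \<ge> c" by blast
  have smooth: "smooth_on U (f n)" for n using f(1) unfolding bounded_class_def by blast
  have bound: "cmod (iter_pd is (f n) x) \<le> (if length is < Suc m + n then b (length is) else b' (length is)) * M (length is)"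
    if "x \<in> U" for n "is" x
    using f(1)[of n] that unfolding bounded_class_def by blast
  have bound': "cmod (iter_pd is (f n) x) \<le> C * h ^ length is * M (length is)" if "x \<in> U" for n "is" x
  proof -
    have "(if length is < Suc m + n then b (length is) else b' (length is)) \<le> C * h ^ length is"
      using b'[of "length is"] order_trans[OF b b'] by simp
    from mult_right_mono[OF this less_imp_le[OF M]] bound[OF that] show ?thesis using order_trans by blast
  qed
  show False
  proof (rule weighted_bounded_subsequence[where f = f and M = M, OF U(1) smooth M h(1) bound'])
    fix k g
    assume k: "strict_mono k" and g: "smooth_on U g"
      and lim: "\<And>is x. x \<in> U \<Longrightarrow> (\<lambda>n. iter_pd is (f (k n)) x) \<longlonglongrightarrow> iter_pd is g x"
      and conv: "\<And>K \<epsilon>. compact K \<Longrightarrow> K \<subseteq> U \<Longrightarrow> \<epsilon> > 0 \<Longrightarrow> \<forall>\<^sub>F n in sequentially. \<forall>is. \<forall>x\<in>K.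
        cmod (iter_pd is (f (k n)) x - iter_pd is g x) \<le> \<epsilon> * (2 * h) ^ length is * M (length is)"
    \<comment> \<open>A fixed order eventually lies below the threshold \<open>Suc m + k n\<close>,
      where the smaller bound \<open>b\<close> applies; being non-strict, it survives the
      limit.\<close>
    have "cmod (iter_pd is g x) \<le> b (length is) * M (length is)" if x: "x \<in> U" for "is" x
    proof (rule LIMSEQ_le_const2[OF tendsto_norm[OF lim[OF x]]], intro exI allI impI)
      fix n assume n: "n \<ge> length is"
      then have "length is < Suc m + k n" using strict_mono_imp_increasing[OF k, of n] by linarith
      then show "cmod (iter_pd is (f (k n)) x) \<le> b (length is) * M (length is)"
        using bound[OF x, of "is" "k n"] by simp
    qed
    with g have "g \<in> bounded_class M U b" unfolding bounded_class_def by blast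
    then have qg: "q (restr K g) < c" by (rule ball)
    have h2: "2 * h > 0" using h by simp
    obtain D where D: "D \<ge> 0" "\<And>f. f \<in> E_h M (2 * h) K \<Longrightarrow> q f \<le> D * enn2real (norm_h M (2 * h) K f)"
      using bounded[OF h2] by blast
    \<comment> \<open>The gap between \<open>q (restr K g)\<close> and \<open>c\<close> is positive
      because \<open>ball\<close> is strict. An error \<open>\<epsilon>\<close> in the step
      \<open>2 * h\<close> costs \<open>q\<close> at most \<open>D * \<epsilon>\<close>, less than
      the gap.\<close>
    define \<epsilon> where "\<epsilon> = (c - q (restr K g)) / (D + 1)"
    have \<epsilon>: "\<epsilon> > 0" using qg D by (simp add: \<epsilon>_def)
    obtain n where n: "\<And>is x. x \<in> K \<Longrightarrow>
        cmod (iter_pd is (f (k n)) x - iter_pd is g x) \<le> \<epsilon> * (2 * h) ^ length is * M (length is)"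
      using eventually_happens[OF conv[OF K(1) U(2) \<epsilon>]] by auto
    let ?d = "\<lambda>x. 1 * f (k n) x + (- 1) * g x"
    have smooth_d: "smooth_on U ?d" by (rule smooth_on_linear_combination[OF U(1) smooth g])
    have iter_d: "cmod (iter_pd is ?d x) \<le> \<epsilon> * (2 * h) ^ length is * M (length is)" if "x \<in> K" for "is" x
    proof -
      have "x \<in> U" using that U by blast
      from iter_pd_linear_combination[OF U(1) smooth g this, of "is" 1 "k n" "-1"] n[OF that, of "is"]
      show ?thesis by simp
    qed
    note d = iter_pd_bound_restr[OF M K(2) U smooth_d h2 less_imp_le[OF \<epsilon>] iter_d]
    have "q (restr K ?d) \<le> D * \<epsilon>"
      using D(2)[OF d(1)] mult_left_mono[OF d(2) D(1)] by linarith
    also have "\<dots> < (D + 1) * \<epsilon>" using \<epsilon> by simp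
    also have "\<dots> = c - q (restr K g)" using D(1) by (simp add: \<epsilon>_def)
    finally have qd: "q (restr K ?d) < c - q (restr K g)" .
    have Bg: "cmod (iter_pd is g x) \<le> C * h ^ length is * M (length is)" if "x \<in> K" for "is" x
    proof -
      have "x \<in> U" using that U by blast
      with LIMSEQ_le_const2[OF tendsto_norm[OF lim]] bound' show ?thesis by blast
    qed
    have dE: "restr K ?d \<in> E_compact M K" by (rule subsetD[OF E_h_subset_E_compact[OF M h2] d(1)])
    have gE: "restr K g \<in> E_compact M K"
      by (rule subsetD[OF E_h_subset_E_compact[OF M h(1)] iter_pd_bound_restr(1)[OF M K(2) U g h Bg]])
    have "q (\<lambda>x. restr K ?d x + restr K g x) \<le> q (restr K ?d) + q (restr K g)"
      by (rule seminorm_onD(2)[OF q dE gE])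
    moreover have "(\<lambda>x. restr K ?d x + restr K g x) = restr K (f (k n))"
      by (auto simp: restr_def)
    ultimately show False using qd f(2)[of "k n"] by simp
  qed
qed

text \<open>\<open>r\<close> depends only on \<open>q\<close> and \<open>c\<close>, whereas
  \<open>h\<close> and \<open>C\<close> may vary with \<open>f\<close>: they merely decide into
  which stage of the construction \<open>f\<close> falls.\<close>

lemma ex_seqs_R_ball:
  assumes ball: "\<And>f. f \<in> bounded_class M U (\<lambda>p. 1) \<Longrightarrow> q (restr K f) < c"
  shows "\<exists>r\<in>seqs_R. \<forall>f h C. f \<in> bounded_class M U (\<lambda>p. \<Prod>j=0..p. r j) \<longrightarrow>
    f \<in> bounded_class M U (\<lambda>p. C * h ^ p) \<longrightarrow> q (restr K f) < c"
proof -
  \<comment> \<open>A state is a threshold together with a bound sequence. From the threshold on,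
    the bound is exactly \<open>(k + 1) ^ p\<close>, which is what the next stage enlarges;
    threshold 0 at \<open>k = 0\<close> will give \<open>P 0 = 0\<close>.\<close>
  define good where "good k s \<longleftrightarrow> (\<forall>f\<in>bounded_class M U (snd s). q (restr K f) < c) \<and>
    (\<forall>p\<ge>fst s. snd s p = real (Suc k) ^ p) \<and> (\<forall>p. snd s p \<le> real (Suc k) ^ p) \<and> (k = 0 \<longrightarrow> fst s = 0)"
    for k and s :: "nat \<times> (nat \<Rightarrow> real)"
  have "\<exists>S. \<forall>k. good k (S k) \<and> (fst (S k) < fst (S (Suc k)) \<and>
      (\<forall>p<fst (S (Suc k)). snd (S (Suc k)) p = snd (S k) p))"
  proof (rule dependent_nat_choice)
    show "\<exists>s. good 0 s"
      by (rule exI[of _ "(0, \<lambda>p. 1)"]) (use ball in \<open>simp add: good_def\<close>)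
    fix s k assume s: "good k s"
    have "snd s p \<le> real (Suc (Suc k)) ^ p" for p
    proof -
      have "real (Suc k) ^ p \<le> real (Suc (Suc k)) ^ p" by (rule power_mono) auto
      then show ?thesis using s unfolding good_def by (meson order_trans)
    qed
    then obtain n where n: "n > fst s"
      "\<forall>f\<in>bounded_class M U (\<lambda>p. if p < n then snd s p else real (Suc (Suc k)) ^ p). q (restr K f) < c"
      using enlarge_bounds[of "snd s" "\<lambda>p. real (Suc (Suc k)) ^ p" 1 "real (Suc (Suc k))" c "fst s"] s
      unfolding good_def by auto
    show "\<exists>t. good (Suc k) t \<and> fst s < fst t \<and> (\<forall>p<fst t. snd t p = snd s p)"
      by (rule exI[of _ "(n, \<lambda>p. if p < n then snd s p else real (Suc (Suc k)) ^ p)"])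
        (use n \<open>\<And>p. snd s p \<le> real (Suc (Suc k)) ^ p\<close> in \<open>simp add: good_def\<close>)
  qed
  then obtain S where S: "\<And>k. good k (S k)" "\<And>k. fst (S k) < fst (S (Suc k))"
    "\<And>k p. p < fst (S (Suc k)) \<Longrightarrow> snd (S (Suc k)) p = snd (S k) p" by blast
  define P where "P k = fst (S k)" for k
  have P: "strict_mono P" "P 0 = 0"
    using S(2) S(1)[of 0] by (simp_all add: strict_mono_Suc_iff P_def good_def)
  let ?r = "threshold_seq P"
  have r: "?r \<in> seqs_R" by (rule threshold_seq_in_seqs_R[OF P])
  \<comment> \<open>Below \<open>P (Suc k)\<close> at most \<open>k + 1\<close> thresholds have been
    passed, so \<open>?r p\<close> is at most \<open>k + 1\<close> and the old bound is already
    large enough. From there on the bound is the full power.\<close>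
  have lower: "min (real (Suc k) ^ p) (?r p ^ p) \<le> snd (S k) p" for k p
  proof (induction k)
    case 0
    show ?case using S(1)[of 0] by (simp add: good_def)
  next
    case (Suc k)
    show ?case
    proof (cases "p < P (Suc k)")
      case True
      have "{i. P i \<le> p} \<subseteq> {..k}"
      proof
        fix i assume "i \<in> {i. P i \<le> p}"
        then have "P i < P (Suc k)" using True by simp
        then show "i \<in> {..k}" using strict_mono_less[OF P(1)] by auto
      qed
      then have "card {i. P i \<le> p} \<le> Suc k" using card_mono[of "{..k}"] by fastforce
      then have "?r p \<le> real (Suc k)" unfolding threshold_seq_def of_nat_le_iff .
      then have "?r p ^ p \<le> real (Suc k) ^ p" by (rule power_mono) (simp add: threshold_seq_def)
      with Suc.IH have "?r p ^ p \<le> snd (S k) p" by simp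
      moreover have "snd (S (Suc k)) p = snd (S k) p" using S(3) True unfolding P_def by blast
      ultimately show ?thesis by (simp add: min_le_iff_disj)
    next
      case False
      then have "snd (S (Suc k)) p = real (Suc (Suc k)) ^ p"
        using S(1)[of "Suc k"] unfolding good_def P_def by (meson not_le)
      then show ?thesis by simp
    qed
  qed
  have "q (restr K f) < c"
    if f: "f \<in> bounded_class M U (\<lambda>p. \<Prod>j=0..p. ?r j)" "f \<in> bounded_class M U (\<lambda>p. C * h ^ p)" for f h C
  proof -
    \<comment> \<open>As \<open>C'\<close> is at least 1, it can be absorbed into the base of the
      power for positive orders; order 0 is covered by \<open>?r 0 = 1\<close>. The absolute values
      allow arbitrary \<open>C\<close> and \<open>h\<close>.\<close>
    define C' where "C' = max 1 \<bar>C\<bar>"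
    obtain m :: nat where m: "C' * \<bar>h\<bar> \<le> real m" using real_arch_simple by blast
    have le: "min (\<Prod>j=0..p. ?r j) (C * h ^ p) \<le> snd (S m) p" for p
    proof -
      have "min (\<Prod>j=0..p. ?r j) (C * h ^ p) \<le> min (real (Suc m) ^ p) (?r p ^ p)"
      proof (cases "p = 0")
        case True
        have "?r 0 = 1" using r unfolding seqs_R_def by blast
        with True show ?thesis by simp
      next
        case False
        have "C * h ^ p \<le> \<bar>C * h ^ p\<bar>" by (rule abs_ge_self)
        also have "\<dots> \<le> C' * \<bar>h\<bar> ^ p"
          unfolding abs_mult power_abs by (intro mult_right_mono) (auto simp: C'_def)
        also have "\<dots> \<le> C' ^ p * \<bar>h\<bar> ^ p"
          using False by (intro mult_right_mono self_le_power) (auto simp: C'_def)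
        also have "\<dots> = (C' * \<bar>h\<bar>) ^ p" by (simp add: power_mult_distrib)
        also have "\<dots> \<le> real (Suc m) ^ p" using m by (intro power_mono) (auto simp: C'_def)
        finally show ?thesis using prod_seqs_R_le[OF r, of p] by auto
      qed
      with lower[of m p] show ?thesis by linarith
    qed
    have "cmod (iter_pd is f x) \<le> snd (S m) (length is) * M (length is)" if "x \<in> U" for "is" x
    proof -
      have "cmod (iter_pd is f x) \<le> (\<Prod>j=0..length is. ?r j) * M (length is)"
        "cmod (iter_pd is f x) \<le> (C * h ^ length is) * M (length is)"
        using f that unfolding bounded_class_def by blast+
      then have "cmod (iter_pd is f x) \<le> min (\<Prod>j=0..length is. ?r j) (C * h ^ length is) * M (length is)"
        by (simp add: min_def)
      also have "\<dots> \<le> snd (S m) (length is) * M (length is)"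
        by (rule mult_right_mono[OF le less_imp_le[OF M]])
      finally show ?thesis .
    qed
    then have "f \<in> bounded_class M U (snd (S m))" using f(1) unfolding bounded_class_def by blast
    then show ?thesis using S(1)[of m] unfolding good_def by blast
  qed
  with r show ?thesis by blast
qed

end


section \<open>The projective description\<close>

lemma topology_eq_if_continuous_id:
  assumes "topspace X = topspace Y" "continuous_map X Y (\<lambda>x. x)" "continuous_map Y X (\<lambda>x. x)"
  shows "X = Y"
proof -
  have "openin X U" if "openin Y U" "continuous_map X Y (\<lambda>x. x)" "topspace X = topspace Y"
    for X Y :: "'a topology" and U
  proof -
    have "openin X {x \<in> topspace X. x \<in> U}"
      using openin_continuous_map_preimage[OF that(2,1)] .
    moreover have "{x \<in> topspace X. x \<in> U} = U" using openin_subset[OF that(1)] that(3) by blast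
    ultimately show ?thesis by simp
  qed
  from this[OF _ assms(2,1)] this[OF _ assms(3) assms(1)[symmetric]] show ?thesis
    unfolding topology_eq by blast
qed

section \<open>Membership and the two comparisons of the topologies\<close>

context
  fixes M :: "nat \<Rightarrow> real" and \<Omega> :: "(real^'n::finite) set"
  assumes M_pos: "\<And>p. M p > 0" and \<Omega>: "open \<Omega>"
begin

lemma seqs_R_weight_pos:
  assumes "r \<in> seqs_R"
  shows "M p * (\<Prod>j=0..p. r j) > 0"
  using assms M_pos by (intro mult_pos_pos prod_pos) (auto simp: seqs_R_def)

lemma mem_E_openD:
  assumes "\<phi> \<in> E_open M \<Omega>"
  shows "smooth_on \<Omega> \<phi>"
    "compact K \<Longrightarrow> K \<subseteq> \<Omega> \<Longrightarrow> \<exists>h>0. wsup K (\<lambda>p. h ^ p * M p) (\<lambda>\<alpha>. mpd \<alpha> \<phi>) < \<infinity>"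
  using assms unfolding mem_E_open_iff[where M = M, OF M_pos \<Omega>] C_inf_def by blast+

text \<open>\<open>C\<close> is chosen before \<open>D\<close>, \<open>K\<close> and
  \<open>c\<close>. This uniformity turns a finiteness statement into continuity of
  \<open>norm_r\<close> on a step.\<close>

lemma wsup_seqs_R_le_geometric:
  assumes r: "r \<in> seqs_R" and h: "h > 0"
  obtains C where "C > 0"
    "\<And>D :: ('n \<Rightarrow> nat) \<Rightarrow> real^'n \<Rightarrow> complex. \<And>K c. c \<ge> 0 \<Longrightarrow>
      (\<And>\<alpha> x. x \<in> K \<Longrightarrow> cmod (D \<alpha> x) \<le> c * (h ^ mi_abs \<alpha> * M (mi_abs \<alpha>))) \<Longrightarrow>
      wsup K (\<lambda>p. M p * (\<Prod>j=0..p. r j)) D \<le> ennreal (C * c)"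
proof -
  obtain C where C: "C > 0" "\<And>p. h ^ p \<le> C * (\<Prod>j=0..p. r j)"
    using power_le_prod_seqs_R[OF r h] by blast
  show ?thesis
  proof (rule that[OF C(1)])
    fix D :: "('n \<Rightarrow> nat) \<Rightarrow> real^'n \<Rightarrow> complex" and K c
    assume c: "c \<ge> 0"
      and bound: "\<And>\<alpha> x. x \<in> K \<Longrightarrow> cmod (D \<alpha> x) \<le> c * (h ^ mi_abs \<alpha> * M (mi_abs \<alpha>))"
    show "wsup K (\<lambda>p. M p * (\<Prod>j=0..p. r j)) D \<le> ennreal (C * c)"
    proof (subst wsup_le_iff, rule seqs_R_weight_pos[OF r], use c C in simp, intro allI ballI)
      fix \<alpha> :: "'n \<Rightarrow> nat" and x assume "x \<in> K"
      have "c * (h ^ mi_abs \<alpha> * M (mi_abs \<alpha>)) \<le> c * ((C * (\<Prod>j=0..mi_abs \<alpha>. r j)) * M (mi_abs \<alpha>))"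
        using c less_imp_le[OF M_pos] by (intro mult_left_mono mult_right_mono C(2))
      with bound[OF \<open>x \<in> K\<close>, of \<alpha>]
      show "cmod (D \<alpha> x) \<le> C * c * (M (mi_abs \<alpha>) * (\<Prod>j=0..mi_abs \<alpha>. r j))"
        by (simp add: mult_ac)
    qed
  qed
qed

lemma norm_r_finite:
  assumes "\<phi> \<in> E_open M \<Omega>" "compact K" "K \<subseteq> \<Omega>" "r \<in> seqs_R"
  shows "norm_r M r K \<phi> < \<infinity>"
proof -
  obtain h where h: "h > 0" "wsup K (\<lambda>p. h ^ p * M p) (\<lambda>\<alpha>. mpd \<alpha> \<phi>) < \<infinity>"
    using mem_E_openD(2)[OF assms(1-3)] by blast
  have w: "h ^ p * M p > 0" for p using M_pos h by simp
  obtain c where c: "c \<ge> 0" "\<And>\<alpha> x. x \<in> K \<Longrightarrow> cmod (mpd \<alpha> \<phi> x) \<le> c * (h ^ mi_abs \<alpha> * M (mi_abs \<alpha>))"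
    using h(2) unfolding wsup_less_top_iff[where w = "\<lambda>p. h ^ p * M p", OF w] by blast
  show ?thesis
  proof (rule wsup_seqs_R_le_geometric[OF assms(4) h(1)])
    fix C assume "C > 0" and bound: "\<And>D :: ('n \<Rightarrow> nat) \<Rightarrow> real^'n \<Rightarrow> complex. \<And>K c. c \<ge> 0 \<Longrightarrow>
      (\<And>\<alpha> x. x \<in> K \<Longrightarrow> cmod (D \<alpha> x) \<le> c * (h ^ mi_abs \<alpha> * M (mi_abs \<alpha>))) \<Longrightarrow>
      wsup K (\<lambda>p. M p * (\<Prod>j=0..p. r j)) D \<le> ennreal (C * c)"
    have "norm_r M r K \<phi> \<le> ennreal (C * c)" unfolding norm_r_def by (intro bound c)
    then show ?thesis by (simp add: le_less_trans[OF _ ennreal_less_top])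
  qed
qed

lemma mem_E_open_if_norm_r_finite:
  assumes \<phi>: "\<phi> \<in> C_inf \<Omega>"
    and fin: "\<And>K r. compact K \<Longrightarrow> K \<subseteq> \<Omega> \<Longrightarrow> r \<in> seqs_R \<Longrightarrow> norm_r M r K \<phi> < \<infinity>"
  shows "\<phi> \<in> E_open M \<Omega>"
  unfolding mem_E_open_iff[where M = M, OF M_pos \<Omega>]
proof (intro conjI allI impI \<phi>)
  fix K :: "(real^'n) set" assume K: "compact K \<and> K \<subseteq> \<Omega>"
  \<comment> \<open>The suprema of these sets form the single sequence to which
    \<open>geometric_bound_if_seqs_R_bounds\<close> applies. Inserting 0 keeps them nonempty when
    \<open>K\<close> is empty.\<close>
  define A where "A p = insert 0 {cmod (mpd \<alpha> \<phi> x) / M p |\<alpha> x. mi_abs \<alpha> = p \<and> x \<in> K}" for p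
  have A_le: "a \<le> enn2real (norm_r M r K \<phi>) * (\<Prod>j=0..p. r j)" if r: "r \<in> seqs_R" and "a \<in> A p" for r p a
  proof (cases "a = 0")
    case True
    then show ?thesis using r by (auto intro!: mult_nonneg_nonneg prod_nonneg simp: seqs_R_def less_imp_le)
  next
    case False
    then obtain \<alpha> x where a: "a = cmod (mpd \<alpha> \<phi> x) / M p" "mi_abs \<alpha> = p" "x \<in> K"
      using \<open>a \<in> A p\<close> unfolding A_def by blast
    have fin': "wsup K (\<lambda>p. M p * (\<Prod>j=0..p. r j)) (\<lambda>\<alpha>. mpd \<alpha> \<phi>) < \<infinity>"
      using fin[of K r] K r unfolding norm_r_def by blast
    have "cmod (mpd \<alpha> \<phi> x) \<le> enn2real (norm_r M r K \<phi>) * (M p * (\<Prod>j=0..p. r j))"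
      unfolding norm_r_def a(2)[symmetric]
      by (rule cmod_le_wsup[where w = "\<lambda>p. M p * (\<Prod>j=0..p. r j)", OF seqs_R_weight_pos[OF r] fin' a(3)])
    then show ?thesis unfolding a(1) pos_divide_le_eq[OF M_pos] by (simp add: mult_ac)
  qed
  \<comment> \<open>Any one member of \<open>seqs_R\<close> shows that \<open>A p\<close> is bounded
    above; this one is \<open>j + 1\<close>.\<close>
  have "threshold_seq (\<lambda>k. k) \<in> seqs_R"
    by (rule threshold_seq_in_seqs_R) (simp_all add: strict_mono_def)
  then have bdd: "bdd_above (A p)" for p using A_le unfolding bdd_above_def by blast
  have nonneg: "Sup (A p) \<ge> 0" for p by (rule cSup_upper[OF _ bdd]) (simp add: A_def)
  have "Sup (A p) \<le> enn2real (norm_r M r K \<phi>) * (\<Prod>j=0..p. r j)" if "r \<in> seqs_R" for r p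
    by (rule cSup_least) (simp add: A_def, rule A_le[OF that])
  then obtain h C where h: "h > 0" and C: "\<And>p. Sup (A p) \<le> C * h ^ p"
    using geometric_bound_if_seqs_R_bounds[of "\<lambda>p. Sup (A p)", OF nonneg] by blast
  have "C \<ge> 0" using nonneg[of 0] C[of 0] by simp
  moreover have "cmod (mpd \<alpha> \<phi> x) \<le> C * (h ^ mi_abs \<alpha> * M (mi_abs \<alpha>))" if "x \<in> K" for \<alpha> x
  proof -
    have "cmod (mpd \<alpha> \<phi> x) / M (mi_abs \<alpha>) \<in> A (mi_abs \<alpha>)" using that unfolding A_def by blast
    from order_trans[OF cSup_upper[OF this bdd] C] show ?thesis
      unfolding pos_divide_le_eq[OF M_pos] by (simp add: mult_ac)
  qed
  moreover have "h ^ p * M p > 0" for p using h M_pos by simp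
  ultimately have "wsup K (\<lambda>p. h ^ p * M p) (\<lambda>\<alpha>. mpd \<alpha> \<phi>) < \<infinity>"
    by (subst wsup_less_top_iff) blast+
  with h show "\<exists>h>0. wsup K (\<lambda>p. h ^ p * M p) (\<lambda>\<alpha>. mpd \<alpha> \<phi>) < \<infinity>" by blast
qed

lemma seminorm_on_norm_r:
  assumes "compact K" "K \<subseteq> \<Omega>" "r \<in> seqs_R"
  shows "seminorm_on (E_open M \<Omega>) (\<lambda>\<phi>. enn2real (norm_r M r K \<phi>))"
  unfolding norm_r_def
proof (rule seminorm_on_wsup[OF seqs_R_weight_pos[OF assms(3)]])
  show "wsup K (\<lambda>p. M p * (\<Prod>j=0..p. r j)) (\<lambda>\<alpha>. mpd \<alpha> \<phi>) < \<infinity>" if "\<phi> \<in> E_open M \<Omega>" for \<phi>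
    using norm_r_finite[OF that assms] unfolding norm_r_def .
  show "mpd \<alpha> (\<lambda>x. c * f x + d * g x) x = c * mpd \<alpha> f x + d * mpd \<alpha> g x"
    if "f \<in> E_open M \<Omega>" "g \<in> E_open M \<Omega>" "x \<in> K" for f g c d \<alpha> x
    using that mem_E_openD(1) assms(2) by (intro mpd_linear_combination[OF \<Omega>]) auto
qed

lemma E_compact_topology_eq:
  "E_compact_topology M K = seminorm_topology (E_compact M K)
    {q. seminorm_on (E_compact M K) q \<and>
      (\<forall>h>0. continuous_map (E_h_topology M h K) (seminorm_topology (E_compact M K) {q}) (\<lambda>f. f))}"
proof -
  have "topspace (E_h_topology M h K) \<subseteq> E_compact M K" if "h \<in> {0<..}" for h
    using E_h_subset_E_compact[where M = M, OF M_pos] that unfolding E_h_topology_def by simp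
  from lc_inductive_topology_eq[where I = "{0<..}" and X = "\<lambda>h. E_h_topology M h K", OF this]
  show ?thesis unfolding E_compact_topology_def Ball_def greaterThan_iff .
qed

lemma continuous_map_restr:
  assumes "K \<in> regular_compacts \<Omega>"
  shows "continuous_map (E_open_topology M \<Omega>) (E_compact_topology M K) (restr K)"
proof -
  have "continuous_map (E_open_topology M \<Omega>) (E_compact_topology M K)
    ((\<lambda>f. f K) \<circ> (\<lambda>\<phi>. \<lambda>K\<in>regular_compacts \<Omega>. restr K \<phi>))"
    unfolding E_open_topology_def
    by (intro continuous_map_pullback continuous_map_product_projection assms)
  moreover have "(\<lambda>f. f K) \<circ> (\<lambda>\<phi>. \<lambda>K\<in>regular_compacts \<Omega>. restr K \<phi>) = restr K"
    using assms by (simp add: fun_eq_iff)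
  ultimately show ?thesis by simp
qed

text \<open>\<open>K\<close> lies in the interior of the regular compact \<open>closure U\<close>,
  so \<open>norm_r\<close> over \<open>K\<close> makes sense on
  \<open>E_compact M (closure U)\<close> and is continuous on every step there. The ball in question
  is the preimage of a ball under restriction.\<close>

lemma openin_E_open_topology_sball:
  assumes K: "compact K" "K \<subseteq> \<Omega>" and r: "r \<in> seqs_R" and f: "f \<in> E_open M \<Omega>" and e: "e > 0"
  shows "openin (E_open_topology M \<Omega>) (sball (E_open M \<Omega>) (\<lambda>\<phi>. enn2real (norm_r M r K \<phi>)) f e)"
proof -
  let ?p = "\<lambda>\<phi>. enn2real (norm_r M r K \<phi>)"
  obtain U where U: "open U" "K \<subseteq> U" "closure U \<in> regular_compacts \<Omega>"
    using ex_regular_nbhd[OF \<Omega> K] by blast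
  let ?L = "closure U"
  have L: "closure (interior ?L) = ?L" using U(3) by (simp add: regular_compacts_def)
  have KL: "x \<in> interior ?L" "x \<in> ?L" if "x \<in> K" for x
    using that U closure_subset interior_maximal by blast+
  have w: "h ^ p * M p > 0" if "h > 0" for h p using that M_pos by simp
  have step: "\<exists>C>0. \<forall>g\<in>E_h M h ?L. norm_r M r K g \<le> ennreal (C * enn2real (norm_h M h ?L g))"
    if h: "h > 0" for h
  proof (rule wsup_seqs_R_le_geometric[OF r h])
    fix C assume C: "C > 0" and bound: "\<And>D :: ('n \<Rightarrow> nat) \<Rightarrow> real^'n \<Rightarrow> complex. \<And>K c. c \<ge> 0 \<Longrightarrow>
      (\<And>\<alpha> x. x \<in> K \<Longrightarrow> cmod (D \<alpha> x) \<le> c * (h ^ mi_abs \<alpha> * M (mi_abs \<alpha>))) \<Longrightarrow>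
      wsup K (\<lambda>p. M p * (\<Prod>j=0..p. r j)) D \<le> ennreal (C * c)"
    have "norm_r M r K g \<le> ennreal (C * enn2real (norm_h M h ?L g))" if g: "g \<in> E_h M h ?L" for g
      unfolding norm_r_def
    proof (rule bound)
      fix \<alpha> x assume x: "x \<in> K"
      have "mpd \<alpha> g x = ext_pd ?L \<alpha> g x"
        using g KL(1)[OF x] unfolding E_h_def by (intro ext_pd_interior[symmetric]) auto
      moreover have "cmod (ext_pd ?L \<alpha> g x) \<le> enn2real (norm_h M h ?L g) * (h ^ mi_abs \<alpha> * M (mi_abs \<alpha>))"
        using g KL(2)[OF x] unfolding E_h_def norm_h_def
        by (intro cmod_le_wsup[where w = "\<lambda>p. h ^ p * M p", OF w[OF h]]) auto
      ultimately show "cmod (mpd \<alpha> g x) \<le> enn2real (norm_h M h ?L g) * (h ^ mi_abs \<alpha> * M (mi_abs \<alpha>))" by simp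
    qed simp
    with C show ?thesis by blast
  qed
  have p: "seminorm_on (E_compact M ?L) ?p"
    unfolding norm_r_def
  proof (rule seminorm_on_wsup[OF seqs_R_weight_pos[OF r]])
    show "wsup K (\<lambda>p. M p * (\<Prod>j=0..p. r j)) (\<lambda>\<alpha>. mpd \<alpha> g) < \<infinity>" if g: "g \<in> E_compact M ?L" for g
    proof -
      obtain h where "h > 0" "g \<in> E_h M h ?L" using g unfolding E_compact_def by auto
      with step obtain C where "norm_r M r K g \<le> ennreal (C * enn2real (norm_h M h ?L g))" by blast
      then show ?thesis unfolding norm_r_def by (simp add: le_less_trans[OF _ ennreal_less_top])
    qed
    show "mpd \<alpha> (\<lambda>x. c * f x + d * g x) x = c * mpd \<alpha> f x + d * mpd \<alpha> g x"
      if "f \<in> E_compact M ?L" "g \<in> E_compact M ?L" "x \<in> K" for f g c d \<alpha> x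
      using that KL(1) unfolding E_compact_def E_h_def C_inf_compact_def
      by (intro mpd_linear_combination[OF open_interior]) auto
  qed
  have "continuous_map (E_h_topology M h ?L) (seminorm_topology (E_compact M ?L) {?p}) (\<lambda>f. f)"
    if h: "h > 0" for h
    unfolding E_h_topology_def
  proof (rule continuous_map_seminorm_topologyI)
    show "func_subspace (E_h M h ?L)" by (rule func_subspace_E_h[OF M_pos L h])
    show "func_subspace (E_compact M ?L)" by (rule func_subspace_E_compact[OF M_pos L])
    show "g \<in> E_compact M ?L" if "g \<in> E_h M h ?L" for g
      using that E_h_subset_E_compact[where M = M, OF M_pos h] by blast
    show "seminorm_on (E_h M h ?L) q" if "q \<in> {\<lambda>f. enn2real (norm_h M h ?L f)}" for q
      using that seminorm_on_norm_h[where M = M, OF M_pos L h] by simp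
    show "seminorm_on (E_compact M ?L) q" if "q \<in> {?p}" for q using that p by simp
    obtain C where C: "C > 0" "\<And>g. g \<in> E_h M h ?L \<Longrightarrow> norm_r M r K g \<le> ennreal (C * enn2real (norm_h M h ?L g))"
      using step[OF h] by blast
    have "?p g \<le> C * enn2real (norm_h M h ?L g)" if "g \<in> E_h M h ?L" for g
      using C(1) by (intro enn2real_leI C(2)[OF that]) simp
    then show "\<exists>p\<in>{\<lambda>f. enn2real (norm_h M h ?L f)}. \<exists>C\<ge>0. \<forall>g\<in>E_h M h ?L. q g \<le> C * p g"
      if "q \<in> {?p}" for q
    proof -
      have "q = ?p" using that by simp
      with \<open>\<And>g. g \<in> E_h M h ?L \<Longrightarrow> ?p g \<le> C * enn2real (norm_h M h ?L g)\<close> C(1) show ?thesis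
        by (intro bexI[of _ "\<lambda>f. enn2real (norm_h M h ?L f)"] exI[of _ C]) auto
    qed
  qed simp
  with p have p_in: "?p \<in> {q. seminorm_on (E_compact M ?L) q \<and>
      (\<forall>h>0. continuous_map (E_h_topology M h ?L) (seminorm_topology (E_compact M ?L) {q}) (\<lambda>f. f))}"
    by blast
  have fL: "restr ?L f \<in> E_compact M ?L" using f U(3) unfolding E_open_def by blast
  have "openin (E_compact_topology M ?L) (sball (E_compact M ?L) ?p (restr ?L f) e)"
    unfolding E_compact_topology_eq by (rule openin_sball[OF p_in fL e])
  from openin_continuous_map_preimage[OF continuous_map_restr[OF U(3)] this]
  have "openin (E_open_topology M \<Omega>)
    {\<phi> \<in> E_open M \<Omega>. restr ?L \<phi> \<in> sball (E_compact M ?L) ?p (restr ?L f) e}" by simp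
  \<comment> \<open>Derivatives on \<open>K\<close> see only values in \<open>U\<close>, where
    restricting to \<open>closure U\<close> changes nothing.\<close>
  moreover have "norm_r M r K (\<lambda>x. restr ?L \<phi> x - restr ?L f x) = norm_r M r K (\<lambda>x. \<phi> x - f x)" for \<phi>
    unfolding norm_r_def restr_diff[symmetric]
  proof (rule wsup_cong)
    fix \<alpha> x assume "x \<in> K"
    then have "x \<in> U" using U by blast
    then show "mpd \<alpha> (restr ?L (\<lambda>x. \<phi> x - f x)) x = mpd \<alpha> (\<lambda>x. \<phi> x - f x) x"
      by (rule mpd_cong[OF U(1)]) (use closure_subset in \<open>auto simp: restr_def\<close>)
  qed
  moreover have "restr ?L \<phi> \<in> E_compact M ?L" if "\<phi> \<in> E_open M \<Omega>" for \<phi>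
    using that U(3) unfolding E_open_def by blast
  ultimately show ?thesis unfolding sball_def by (simp cong: conj_cong)
qed

text \<open>The compact set grows from \<open>K\<close> to \<open>closure U\<close>, because the
  compactness argument needs bounds on an open neighbourhood of \<open>K\<close>.\<close>

lemma step_continuous_seminorm_dominated:
  assumes K_regular: "K \<in> regular_compacts \<Omega>" and q: "seminorm_on (E_compact M K) q"
    and cont: "\<And>h. h > 0 \<Longrightarrow>
      continuous_map (E_h_topology M h K) (seminorm_topology (E_compact M K) {q}) (\<lambda>f. f)"
  shows "\<exists>L r. compact L \<and> L \<subseteq> \<Omega> \<and> r \<in> seqs_R \<and>
    (\<exists>C\<ge>0. \<forall>\<phi>\<in>E_open M \<Omega>. q (restr K \<phi>) \<le> C * enn2real (norm_r M r L \<phi>))"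
proof -
  have K': "compact K" "closure (interior K) = K" "K \<subseteq> \<Omega>" using K_regular by (auto simp: regular_compacts_def)
  obtain U where U: "open U" "K \<subseteq> U" "closure U \<in> regular_compacts \<Omega>"
    using ex_regular_nbhd[OF \<Omega> K'(1,3)] by blast
  let ?L = "closure U"
  have L: "compact ?L" "?L \<subseteq> \<Omega>" using U(3) by (auto simp: regular_compacts_def)
  have U\<Omega>: "U \<subseteq> \<Omega>" using L(2) closure_subset by blast
  have bounded: "\<exists>C\<ge>0. \<forall>f\<in>E_h M h K. q f \<le> C * enn2real (norm_h M h K f)" if h: "h > 0" for h
    by (rule continuous_map_seminorm_topologyD[OF func_subspace_E_h[OF M_pos K'(2) h]
          seminorm_on_norm_h[OF M_pos K'(2) h] q E_h_subset_E_compact[OF M_pos h]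
          cont[OF h, unfolded E_h_topology_def]])
  interpret step_continuous_seminorm M K U q
    by unfold_locales (fact M_pos K' U q bounded)+
  obtain D where D: "D \<ge> 0" "\<And>f. f \<in> E_h M 1 K \<Longrightarrow> q f \<le> D * enn2real (norm_h M 1 K f)"
    using bounded[OF zero_less_one] by blast
  \<comment> \<open>The start of the enlargement: on the unit class of the step
    \<open>h = 1\<close>, \<open>q\<close> is at most \<open>D\<close>, and \<open>D + 1\<close>
    makes this strict.\<close>
  have "q (restr K f) < D + 1" if f: "f \<in> bounded_class M U (\<lambda>p. 1)" for f
  proof -
    have b: "cmod (iter_pd is f x) \<le> 1 * 1 ^ length is * M (length is)" if "x \<in> K" for "is" x
      using f that U unfolding bounded_class_def by auto
    have smooth: "smooth_on U f" using f unfolding bounded_class_def by blast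
    note 1 = iter_pd_bound_restr[OF M_pos K'(2) U(1,2) smooth zero_less_one zero_le_one b]
    show ?thesis using D(2)[OF 1(1)] mult_left_mono[OF 1(2) D(1)] by linarith
  qed
  from ex_seqs_R_ball[OF this] obtain r where r: "r \<in> seqs_R"
    and ball: "\<And>f h C. f \<in> bounded_class M U (\<lambda>p. \<Prod>j=0..p. r j) \<Longrightarrow>
      f \<in> bounded_class M U (\<lambda>p. C * h ^ p) \<Longrightarrow> q (restr K f) < D + 1" by blast
  have in_class: "\<phi> \<in> bounded_class M U b"
    if "smooth_on \<Omega> \<phi>" "\<And>\<alpha> x. x \<in> ?L \<Longrightarrow> cmod (mpd \<alpha> \<phi> x) \<le> b (mi_abs \<alpha>) * M (mi_abs \<alpha>)" for \<phi> b
  proof -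
    have "\<forall>is. \<forall>x\<in>U. cmod (iter_pd is \<phi> x) \<le> b (length is) * M (length is)"
      by (subst all_mpd_iff_all_iter_pd[OF \<Omega> that(1) U\<Omega>,
            of "\<lambda>z p. cmod z \<le> b p * M p", symmetric]) (use that(2) closure_subset in blast)
    then show ?thesis using smooth_on_subset[OF that(1) U\<Omega>] unfolding bounded_class_def by blast
  qed
  let ?p = "\<lambda>\<phi>. enn2real (norm_r M r ?L \<phi>)"
  have restr_in: "restr K \<phi> \<in> E_compact M K" if "\<phi> \<in> E_open M \<Omega>" for \<phi>
    using that K_regular unfolding E_open_def by blast
  have qV: "seminorm_on (E_open M \<Omega>) (\<lambda>\<phi>. q (restr K \<phi>))"
    unfolding seminorm_on_def
  proof (intro conjI ballI allI)
    fix f g c assume f: "f \<in> E_open M \<Omega>"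
    show "q (restr K f) \<ge> 0" by (rule seminorm_onD(1)[OF q restr_in[OF f]])
    have "restr K (\<lambda>x. c * f x) = (\<lambda>x. c * restr K f x)" by (auto simp: restr_def)
    then show "q (restr K (\<lambda>x. c * f x)) = cmod c * q (restr K f)"
      using seminorm_onD(3)[OF q restr_in[OF f]] by simp
    assume g: "g \<in> E_open M \<Omega>"
    have "restr K (\<lambda>x. f x + g x) = (\<lambda>x. restr K f x + restr K g x)" by (auto simp: restr_def)
    then show "q (restr K (\<lambda>x. f x + g x)) \<le> q (restr K f) + q (restr K g)"
      using seminorm_onD(2)[OF q restr_in[OF f] restr_in[OF g]] by simp
  qed
  have "q (restr K \<phi>) \<le> D + 1" if \<phi>: "\<phi> \<in> E_open M \<Omega>" and small: "?p \<phi> < 1" for \<phi>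
  proof -
    note smooth = mem_E_openD(1)[OF \<phi>]
    have "cmod (mpd \<alpha> \<phi> x) \<le> (\<Prod>j=0..mi_abs \<alpha>. r j) * M (mi_abs \<alpha>)" if "x \<in> ?L" for \<alpha> x
    proof -
      have "cmod (mpd \<alpha> \<phi> x) \<le> ?p \<phi> * (M (mi_abs \<alpha>) * (\<Prod>j=0..mi_abs \<alpha>. r j))"
        using norm_r_finite[OF \<phi> L r] that unfolding norm_r_def
        by (intro cmod_le_wsup[where w = "\<lambda>p. M p * (\<Prod>j=0..p. r j)", OF seqs_R_weight_pos[OF r]])
      also have "\<dots> \<le> 1 * (M (mi_abs \<alpha>) * (\<Prod>j=0..mi_abs \<alpha>. r j))"
        using small less_imp_le[OF seqs_R_weight_pos[OF r]] by (intro mult_right_mono) auto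
      finally show ?thesis by (simp add: mult.commute)
    qed
    note 1 = in_class[of \<phi> "\<lambda>p. \<Prod>j=0..p. r j", OF smooth this]
    \<comment> \<open>Membership in \<open>E_open M \<Omega>\<close> supplies the geometric bound
      that \<open>ball\<close> demands in addition; its constants may depend on \<phi>.\<close>
    obtain h where h: "h > 0" "wsup ?L (\<lambda>p. h ^ p * M p) (\<lambda>\<alpha>. mpd \<alpha> \<phi>) < \<infinity>"
      using mem_E_openD(2)[OF \<phi> L] by blast
    have w: "h ^ p * M p > 0" for p using M_pos h by simp
    obtain c where c: "\<And>\<alpha> x. x \<in> ?L \<Longrightarrow> cmod (mpd \<alpha> \<phi> x) \<le> c * (h ^ mi_abs \<alpha> * M (mi_abs \<alpha>))"
      using h(2) unfolding wsup_less_top_iff[where w = "\<lambda>p. h ^ p * M p", OF w] by blast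
    have "\<phi> \<in> bounded_class M U (\<lambda>p. c * h ^ p)"
      using c by (intro in_class smooth) (simp add: mult.assoc)
    from ball[OF 1 this] show ?thesis by simp
  qed
  from seminorm_on_dominated[OF func_subspace_E_open[OF M_pos \<Omega>] seminorm_on_norm_r[OF L r] qV zero_less_one _ this]
  have "q (restr K \<phi>) \<le> 2 * (D + 1) / 1 * ?p \<phi>" if "\<phi> \<in> E_open M \<Omega>" for \<phi>
    using D(1) that by simp
  moreover have "2 * (D + 1) / 1 \<ge> 0" using D(1) by simp
  ultimately show ?thesis using L r by blast
qed

text \<open>The inverse direction can be tested on one regular compact set at a time, since the
  projective limit carries the topology induced by a product.\<close>

lemma E_open_topology_eq:
  "E_open_topology M \<Omega> = seminorm_topology (E_open M \<Omega>)
    {\<lambda>\<phi>. enn2real (norm_r M r K \<phi>) | K r. compact K \<and> K \<subseteq> \<Omega> \<and> r \<in> seqs_R}"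
  (is "_ = seminorm_topology ?V ?P")
proof (rule topology_eq_if_continuous_id)
  show "continuous_map (E_open_topology M \<Omega>) (seminorm_topology ?V ?P) (\<lambda>\<phi>. \<phi>)"
    unfolding continuous_map_seminorm_topology_iff
  proof (intro conjI ballI allI impI)
    fix p f and e :: real assume "p \<in> ?P" "f \<in> ?V" "e > 0"
    then have "openin (E_open_topology M \<Omega>) (sball ?V p f e)"
      using openin_E_open_topology_sball by blast
    moreover have "(\<lambda>\<phi>. \<phi>) -` sball ?V p f e \<inter> topspace (E_open_topology M \<Omega>) = sball ?V p f e"
      using sball_subset[of ?V p f e] by auto
    ultimately show "openin (E_open_topology M \<Omega>)
      ((\<lambda>\<phi>. \<phi>) -` sball ?V p f e \<inter> topspace (E_open_topology M \<Omega>))" by simp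
  qed simp
  have restr: "continuous_map (seminorm_topology ?V ?P) (E_compact_topology M K) (restr K)"
    if K: "K \<in> regular_compacts \<Omega>" for K
    unfolding E_compact_topology_eq
  proof (rule continuous_map_seminorm_topologyI)
    show "func_subspace ?V" by (rule func_subspace_E_open[OF M_pos \<Omega>])
    show "func_subspace (E_compact M K)"
      using K by (intro func_subspace_E_compact[OF M_pos]) (simp add: regular_compacts_def)
    show "seminorm_on ?V p" if "p \<in> ?P" for p using that seminorm_on_norm_r by blast
    show "restr K \<phi> \<in> E_compact M K" if "\<phi> \<in> ?V" for \<phi> using that K unfolding E_open_def by blast
    show "\<exists>p\<in>?P. \<exists>C\<ge>0. \<forall>\<phi>\<in>?V. q (restr K \<phi>) \<le> C * p \<phi>"
      if "q \<in> {q. seminorm_on (E_compact M K) q \<and>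
        (\<forall>h>0. continuous_map (E_h_topology M h K) (seminorm_topology (E_compact M K) {q}) (\<lambda>f. f))}" for q
    proof -
      have "seminorm_on (E_compact M K) q" "\<And>h. h > 0 \<Longrightarrow>
        continuous_map (E_h_topology M h K) (seminorm_topology (E_compact M K) {q}) (\<lambda>f. f)"
        using that by auto
      from step_continuous_seminorm_dominated[OF K this] obtain L r
        where "compact L \<and> L \<subseteq> \<Omega> \<and> r \<in> seqs_R"
          and "\<exists>C\<ge>0. \<forall>\<phi>\<in>?V. q (restr K \<phi>) \<le> C * enn2real (norm_r M r L \<phi>)" by blast
      then show ?thesis by (intro bexI[of _ "\<lambda>\<phi>. enn2real (norm_r M r L \<phi>)"]) blast+
    qed
  qed (auto simp: restr_diff)
  show "continuous_map (seminorm_topology ?V ?P) (E_open_topology M \<Omega>) (\<lambda>\<phi>. \<phi>)"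
    unfolding E_open_topology_def
  proof (rule continuous_map_pullback')
    have "continuous_map (seminorm_topology ?V ?P) (product_topology (E_compact_topology M) (regular_compacts \<Omega>))
        (\<lambda>\<phi>. \<lambda>K\<in>regular_compacts \<Omega>. restr K \<phi>)"
      unfolding continuous_map_componentwise
    proof (intro conjI ballI)
      show "continuous_map (seminorm_topology ?V ?P) (E_compact_topology M K)
          (\<lambda>\<phi>. (\<lambda>K\<in>regular_compacts \<Omega>. restr K \<phi>) K)" if "K \<in> regular_compacts \<Omega>" for K
        using restr[OF that] that by simp
    qed auto
    then show "continuous_map (seminorm_topology ?V ?P) (product_topology (E_compact_topology M) (regular_compacts \<Omega>))
        ((\<lambda>\<phi>. \<lambda>K\<in>regular_compacts \<Omega>. restr K \<phi>) \<circ> (\<lambda>\<phi>. \<phi>))"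
      by (simp add: comp_def)
    show "topspace (seminorm_topology ?V ?P) \<subseteq> (\<lambda>\<phi>. \<phi>) -` supp_in \<Omega>"
      by (auto simp: E_open_def)
  qed
qed simp

end

theorem proposition4p8:
  fixes M :: "nat \<Rightarrow> real" and \<Omega> :: "(real^'n::finite) set"
  assumes "weight_sequence M" and "cond_M1 M" and "cond_M2' M" and "cond_QA M"
    and "fact_subset M" and "open \<Omega>"
  shows "(\<forall>\<phi>\<in>C_inf \<Omega>. \<phi> \<in> E_open M \<Omega> \<longleftrightarrow>
            (\<forall>K r. compact K \<and> K \<subseteq> \<Omega> \<and> r \<in> seqs_R \<longrightarrow> norm_r M r K \<phi> < \<infinity>)) \<and>
         (\<forall>K r. compact K \<and> K \<subseteq> \<Omega> \<and> r \<in> seqs_R \<longrightarrow>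
            seminorm_on (E_open M \<Omega>) (\<lambda>\<phi>. enn2real (norm_r M r K \<phi>))) \<and>
         E_open_topology M \<Omega> = seminorm_topology (E_open M \<Omega>)
            {\<lambda>\<phi>. enn2real (norm_r M r K \<phi>) | K r. compact K \<and> K \<subseteq> \<Omega> \<and> r \<in> seqs_R}"
proof (intro conjI ballI allI impI)
  have M: "M p > 0" for p using assms(1) by (simp add: weight_sequence_def)
  show "\<phi> \<in> E_open M \<Omega> \<longleftrightarrow>
      (\<forall>K r. compact K \<and> K \<subseteq> \<Omega> \<and> r \<in> seqs_R \<longrightarrow> norm_r M r K \<phi> < \<infinity>)" if "\<phi> \<in> C_inf \<Omega>" for \<phi>
    using norm_r_finite[where M = M, OF M \<open>open \<Omega>\<close>]
      mem_E_open_if_norm_r_finite[where M = M, OF M \<open>open \<Omega>\<close> that] by blast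
  show "seminorm_on (E_open M \<Omega>) (\<lambda>\<phi>. enn2real (norm_r M r K \<phi>))"
    if "compact K \<and> K \<subseteq> \<Omega> \<and> r \<in> seqs_R" for K r
    using seminorm_on_norm_r[where M = M, OF M \<open>open \<Omega>\<close>] that by blast
  show "E_open_topology M \<Omega> = seminorm_topology (E_open M \<Omega>)
      {\<lambda>\<phi>. enn2real (norm_r M r K \<phi>) | K r. compact K \<and> K \<subseteq> \<Omega> \<and> r \<in> seqs_R}"
    by (rule E_open_topology_eq[OF M \<open>open \<Omega>\<close>])
qed

end
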